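(* Let $H$ and $H'$ be Hilbert spaces, let $\pi:\mathcal{B}(H)\rightarrow\mathcal{B}(H')$ be a homomorphism such that $\pi^{-1}[\{0\}]=\mathcal{K}(H)$, let $(P_n)_{n\in\omega}\subseteq\mathcal{P}(\mathcal{B}(H))$ and take $P\in\mathcal{P}(\mathcal{B}(H))$ with $\mathcal{R}(P)\subseteq\sum\mathcal{R}(P_n)$. Then $\pi(P)=\bigvee\pi(P_n)$ if and only if $\mathcal{R}(P)$ has no closed infinite dimensional extension in $\sum\mathcal{R}(P_n)$, i.e. there is no closed subspace $V$ of $H$ with $\mathcal{R}(P)\subseteq V\subseteq\sum\mathcal{R}(P_n)$ and $V/\mathcal{R}(P)$ infinite dimensional. Hence $\sum\mathcal{R}(P_n)$ is closed if and only if $\pi(\bigvee P_n)=\bigvee\pi(P_n)$.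
   Context: Hilbert spaces are over $\mathbb{F}=\mathbb{R}$ or $\mathbb{C}$. $\mathcal{P}(\mathcal{B}(H))$ is the set of (orthogonal) projections on $H$, $\mathcal{K}(H)$ the set of compact operators on $H$, and $\mathcal{R}(P)$ the range of $P$. $\sum\mathcal{R}(P_n)$ denotes the (possibly not closed) algebraic linear span of the subspaces $\mathcal{R}(P_n)$, i.e. all finite sums of vectors from $\bigcup_n\mathcal{R}(P_n)$. $\bigvee P_n$ is the least upper bound in $\mathcal{P}(\mathcal{B}(H))$, i.e. the projection onto $\overline{\sum\mathcal{R}(P_n)}$, and $\bigvee\pi(P_n)$ is likewise the least upper bound in $\mathcal{P}(\mathcal{B}(H'))$. Homomorphisms preserve addition, (scalar) multiplication, adjoints and the identity operator. *)

theory Defs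
  imports "HOL-Analysis.Analysis"
begin

text \<open>
  Hilbert spaces over \<open>\<real>\<close> and over \<open>\<complex>\<close> are treated together.  The scalar field is a subset \<open>F\<close> of the
  complex numbers, either \<open>\<real>\<close> or all of them.  The underlying real Hilbert space is a type of
  class \<^class>\<open>real_inner\<close> and \<^class>\<open>complete_space\<close>, whose inner product is the real part of the
  \<open>F\<close>-valued one, so norm and topology are those of the type class.
  The value of \<open>scale c\<close> for \<open>c \<notin> F\<close> is irrelevant.
\<close>

record 'a hilbert_structure =
  scale :: "complex \<Rightarrow> 'a \<Rightarrow> 'a"
  ip :: "'a \<Rightarrow> 'a \<Rightarrow> complex"

locale hilbert_space =
  fixes F :: "complex set"
    and H :: "'a::{real_inner, complete_space} hilbert_structure"
  assumes scalars: "F = \<real> \<or> F = UNIV"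
    and scale_of_real: "scale H (of_real r) x = r *\<^sub>R x"
    and scale_add_right: "c \<in> F \<Longrightarrow> scale H c (x + y) = scale H c x + scale H c y"
    and scale_add_left: "c \<in> F \<Longrightarrow> d \<in> F \<Longrightarrow> scale H (c + d) x = scale H c x + scale H d x"
    and scale_scale: "c \<in> F \<Longrightarrow> d \<in> F \<Longrightarrow> scale H c (scale H d x) = scale H (c * d) x"
    and ip_scalar: "ip H x y \<in> F"
    and ip_commute: "ip H y x = cnj (ip H x y)"
    and ip_add_left: "ip H (x + y) z = ip H x z + ip H y z"
    and ip_scale_left: "c \<in> F \<Longrightarrow> ip H (scale H c x) y = c * ip H x y"
    and Re_ip: "Re (ip H x y) = x \<bullet> y"

lemma hilbert_space_real:
  "hilbert_space \<real> \<lparr>scale = (\<lambda>c x :: 'a::{real_inner, complete_space}. Re c *\<^sub>R x),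
                      ip = (\<lambda>x y. of_real (x \<bullet> y))\<rparr>"
  by unfold_locales (auto simp: algebra_simps inner_commute Reals_def)

lemma hilbert_space_complex:
  "hilbert_space UNIV \<lparr>scale = (\<lambda>c x :: complex. c * x), ip = (\<lambda>x y. x * cnj y)\<rparr>"
  by unfold_locales (auto simp: algebra_simps inner_complex_def scaleR_conv_of_real)

definition bounded_ops ::
  "complex set \<Rightarrow> 'a::{real_inner, complete_space} hilbert_structure \<Rightarrow> ('a \<Rightarrow> 'a) set" where
  "bounded_ops F H =
     {A. bounded_linear A \<and> (\<forall>c\<in>F. \<forall>x. A (scale H c x) = scale H c (A x))}"

definition compact_ops ::
  "complex set \<Rightarrow> 'a::{real_inner, complete_space} hilbert_structure \<Rightarrow> ('a \<Rightarrow> 'a) set" where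
  "compact_ops F H = {A \<in> bounded_ops F H. compact (closure (A ` cball 0 1))}"

definition is_adjoint :: "'a hilbert_structure \<Rightarrow> ('a \<Rightarrow> 'a) \<Rightarrow> ('a \<Rightarrow> 'a) \<Rightarrow> bool" where
  "is_adjoint H A B \<longleftrightarrow> (\<forall>x y. ip H (A x) y = ip H x (B y))"

definition projections ::
  "complex set \<Rightarrow> 'a::{real_inner, complete_space} hilbert_structure \<Rightarrow> ('a \<Rightarrow> 'a) set" where
  "projections F H = {P \<in> bounded_ops F H. P \<circ> P = P \<and> is_adjoint H P P}"

text \<open>Projections are ordered by inclusion of their ranges.\<close>

definition is_proj_lub ::
  "complex set \<Rightarrow> 'a::{real_inner, complete_space} hilbert_structure \<Rightarrow> ('a \<Rightarrow> 'a) set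
     \<Rightarrow> ('a \<Rightarrow> 'a) \<Rightarrow> bool" where
  "is_proj_lub F H S Q \<longleftrightarrow>
     Q \<in> projections F H \<and> (\<forall>P\<in>S. range P \<subseteq> range Q) \<and>
     (\<forall>R\<in>projections F H. (\<forall>P\<in>S. range P \<subseteq> range R) \<longrightarrow> range Q \<subseteq> range R)"

definition proj_Sup ::
  "complex set \<Rightarrow> 'a::{real_inner, complete_space} hilbert_structure \<Rightarrow> ('a \<Rightarrow> 'a) set
     \<Rightarrow> ('a \<Rightarrow> 'a)" where
  "proj_Sup F H S = (THE Q. is_proj_lub F H S Q)"

lemma (in hilbert_space) projection_eqI:
  assumes "P \<in> projections F H" "Q \<in> projections F H" "range P = range Q"
  shows "P = Q"
proof
  fix x
  have PP: "P (P y) = P y" and QQ: "Q (Q y) = Q y" for y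
    using assms by (auto simp: projections_def fun_eq_iff)
  have QP: "Q (P y) = P y" for y
    by (metis QQ assms(3) rangeE rangeI)
  have PQ: "P (Q y) = Q y" for y
    by (metis PP assms(3) rangeE rangeI)
  have adjP: "ip H (P u) v = ip H u (P v)" and adjQ: "ip H (Q u) v = ip H u (Q v)" for u v
    using assms(1,2) by (auto simp: projections_def is_adjoint_def)
  have "ip H (P x) y = ip H (Q x) y" for y
  proof -
    have "ip H (P x) y = ip H (Q (P x)) y"
      by (simp only: QP)
    also have "\<dots> = ip H x (P (Q y))"
      by (simp only: adjP adjQ)
    also have "\<dots> = ip H x (Q y)"
      by (simp only: PQ)
    finally show ?thesis
      by (simp only: adjQ)
  qed
  then have "P x \<bullet> y = Q x \<bullet> y" for y
    by (simp flip: Re_ip)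
  then have "(P x - Q x) \<bullet> (P x - Q x) = 0"
    by (simp only: inner_diff_left)
  then show "P x = Q x"
    by simp
qed

lemma (in hilbert_space) proj_Sup_eqI:
  assumes "is_proj_lub F H S Q"
  shows "proj_Sup F H S = Q"
  unfolding proj_Sup_def
proof (rule the_equality)
  fix R
  assume "is_proj_lub F H S R"
  with assms show "R = Q"
    by (intro projection_eqI subset_antisym) (simp_all add: is_proj_lub_def)
qed (rule assms)

text \<open>
  Operators are plain functions, so \<open>\<pi>\<close> is a total function on them; its values outside \<open>\<B>(H)\<close> are
  irrelevant.
\<close>

definition operator_hom ::
  "complex set \<Rightarrow> 'a::{real_inner, complete_space} hilbert_structure
     \<Rightarrow> 'b::{real_inner, complete_space} hilbert_structure
     \<Rightarrow> (('a \<Rightarrow> 'a) \<Rightarrow> ('b \<Rightarrow> 'b)) \<Rightarrow> bool" where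
  "operator_hom F H H' \<pi> \<longleftrightarrow>
     \<pi> \<in> bounded_ops F H \<rightarrow> bounded_ops F H' \<and>
     (\<forall>A\<in>bounded_ops F H. \<forall>B\<in>bounded_ops F H. \<pi> (\<lambda>x. A x + B x) = (\<lambda>y. \<pi> A y + \<pi> B y)) \<and>
     (\<forall>c\<in>F. \<forall>A\<in>bounded_ops F H. \<pi> (\<lambda>x. scale H c (A x)) = (\<lambda>y. scale H' c (\<pi> A y))) \<and>
     (\<forall>A\<in>bounded_ops F H. \<forall>B\<in>bounded_ops F H. \<pi> (A \<circ> B) = \<pi> A \<circ> \<pi> B) \<and>
     (\<forall>A\<in>bounded_ops F H. \<forall>B\<in>bounded_ops F H. is_adjoint H A B \<longrightarrow> is_adjoint H' (\<pi> A) (\<pi> B)) \<and>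
     \<pi> id = id"

definition is_subspace :: "complex set \<Rightarrow> 'a::ab_group_add hilbert_structure \<Rightarrow> 'a set \<Rightarrow> bool" where
  "is_subspace F H V \<longleftrightarrow>
     0 \<in> V \<and> (\<forall>x\<in>V. \<forall>y\<in>V. x + y \<in> V) \<and> (\<forall>c\<in>F. \<forall>x\<in>V. scale H c x \<in> V)"

text \<open>When the \<open>S n\<close> are subspaces, these finite sums form the linear span of their union.\<close>

definition algebraic_sum :: "(nat \<Rightarrow> 'a::ab_group_add set) \<Rightarrow> 'a set" where
  "algebraic_sum S = {(\<Sum>i<k. v i) | (k::nat) v. \<forall>i<k. v i \<in> (\<Union>n. S n)}"

definition quotient_space :: "'a::ab_group_add set \<Rightarrow> 'a set \<Rightarrow> 'a set set" where
  "quotient_space V W = (\<lambda>v. (+) v ` W) ` V"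

text \<open>
  The quotient \<open>V/W\<close> is finite dimensional if it is spanned by the cosets of finitely many vectors
  \<open>b \<in> V\<close>; the combination of the cosets \<open>b + W\<close> with coefficients \<open>c b\<close> is the coset of
  \<open>\<Sum>b\<in>B. c b \<cdot> b\<close>.
\<close>

definition infinite_dim_quotient ::
  "complex set \<Rightarrow> 'a::ab_group_add hilbert_structure \<Rightarrow> 'a set \<Rightarrow> 'a set \<Rightarrow> bool" where
  "infinite_dim_quotient F H V W \<longleftrightarrow>
     \<not> (\<exists>B. finite B \<and> B \<subseteq> V \<and>
          (\<forall>X\<in>quotient_space V W. \<exists>c\<in>B \<rightarrow> F. X = (+) (\<Sum>b\<in>B. scale H (c b) b) ` W))"

end

(*
  If R(P) is contained in the algebraic sum of the ranges R(P_n), a gliding hump argument gives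
  P \<le> C (P_0 + ... + P_(k-1)) for some C and k.  The homomorphism preserves positivity of operators,
  so \<pi>(P) lies below every upper bound of the \<pi>(P_n).  Hence \<pi>(P) is the least upper bound iff
  \<pi>(P_n) \<le> \<pi>(P) for all n, i.e. iff all (1 - P) P_n are compact.  A noncompact (1 - P) P_n is
  bounded below on an infinite dimensional closed subspace, whose image extends R(P); conversely, if
  Q projects onto an extension, then \<pi>(Q) = \<pi>(P) forces the projection Q - P to be compact.

  If the algebraic sum M is not closed, there are orthonormal vectors e_k in M with
  |P_i e_k| \<le> 2^-k for i < k.  The projection K onto their closed span is not compact although all
  P_i K are, so 1 - \<pi>(K) is an upper bound of the \<pi>(P_n) which is not above \<pi>(\<Squnion>P_n).
*)
theory Submission
  imports Defs
begin

section \<open>Operators on a Hilbert space\<close>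

text \<open>The obstacle is that an upper bound of the \<open>\<pi> (Pn n)\<close> is an arbitrary
  projection of the target and need not be a value of \<open>\<pi>\<close>. An inclusion of ranges
  cannot be transported to such a bound directly; an operator inequality with finitely many
  \<open>Pn\<close> can, since \<open>\<pi>\<close> respects finite sums. Hence the inclusion is
  first turned into a domination. No continuity of \<open>\<pi>\<close> is assumed and no square
  roots of positive operators are constructed: preservation of positivity rests on inverting
  coercive operators, and the same inversion serves to show that a sum of ranges contains its
  closure. Both scalar fields are treated through the real inner product, from which the
  scalar-valued one is recovered by testing with all scalars.\<close>

lemma nearest_point:
  fixes V :: "'a::{real_inner, complete_space} set"
  assumes "subspace V" "closed V"
  obtains v where "v \<in> V" "\<And>w. w \<in> V \<Longrightarrow> (x - v) \<bullet> w = 0"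
proof -
  define d where "d = infdist x V"
  have ne: "V \<noteq> {}" using assms(1) subspace_0 by blast
  have d0: "d \<ge> 0" by (simp add: d_def infdist_nonneg)
  have d_le: "d\<^sup>2 \<le> (norm (x - w))\<^sup>2" if "w \<in> V" for w
    using infdist_le[OF that, of x] d0 by (simp add: d_def dist_norm power_mono)
  have "\<exists>v\<in>V. (norm (x - v))\<^sup>2 < d\<^sup>2 + 1 / real (Suc n)" for n
  proof -
    have "d = sqrt (d\<^sup>2)" using d0 by simp
    also have "\<dots> < sqrt (d\<^sup>2 + 1 / real (Suc n))"
      by (rule real_sqrt_less_mono) simp
    finally have "d < sqrt (d\<^sup>2 + 1 / real (Suc n))" .
    then obtain v where v: "v \<in> V" "dist x v < sqrt (d\<^sup>2 + 1 / real (Suc n))"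
      using cInf_lessD[of "dist x ` V"] ne by (auto simp: d_def infdist_def)
    then have "(dist x v)\<^sup>2 < (sqrt (d\<^sup>2 + 1 / real (Suc n)))\<^sup>2"
      by (intro power_strict_mono) auto
    then show ?thesis using v(1) by (auto simp: dist_norm add_nonneg_nonneg)
  qed
  then obtain v where v: "\<And>n. v n \<in> V" "\<And>n. (norm (x - v n))\<^sup>2 < d\<^sup>2 + 1 / real (Suc n)"
    by metis
  \<comment> \<open>Parallelogram law: the midpoint of \<open>v m\<close> and \<open>v n\<close>
    lies in \<open>V\<close>, so its distance from \<open>x\<close> is at least \<open>d\<close>,
    and this forces the two points together.\<close>
  have para: "(norm (v m - v n))\<^sup>2 \<le> 2 / real (Suc m) + 2 / real (Suc n)" for m n
  proof -
    have "(1/2) *\<^sub>R (v m + v n) \<in> V"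
      using v(1) assms(1) by (simp add: subspace_add subspace_scale)
    from d_le[OF this]
    have "4 * d\<^sup>2 \<le> (norm (2 *\<^sub>R (x - (1/2) *\<^sub>R (v m + v n))))\<^sup>2"
      by (simp add: power_mult_distrib)
    also have "2 *\<^sub>R (x - (1/2) *\<^sub>R (v m + v n)) = (x - v m) + (x - v n)"
      by (simp add: algebra_simps scaleR_2)
    finally have "4 * d\<^sup>2 \<le> (norm ((x - v m) + (x - v n)))\<^sup>2" .
    moreover have "(norm (v m - v n))\<^sup>2 + (norm ((x - v m) + (x - v n)))\<^sup>2
        = 2 * (norm (x - v m))\<^sup>2 + 2 * (norm (x - v n))\<^sup>2"
      by (simp add: power2_norm_eq_inner algebra_simps inner_commute)
    ultimately show ?thesis
      using v(2)[of m] v(2)[of n] by simp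
  qed
  have "Cauchy v"
  proof (rule metric_CauchyI)
    fix e :: real assume "e > 0"
    then obtain N where N: "1 / real (Suc N) < e\<^sup>2 / 4"
      using nat_approx_posE[of "e\<^sup>2 / 4"] by (metis divide_pos_pos zero_less_numeral zero_less_power)
    have "dist (v m) (v n) < e" if "m \<ge> N" "n \<ge> N" for m n
    proof -
      have "1 / real (Suc m) \<le> 1 / real (Suc N)" "1 / real (Suc n) \<le> 1 / real (Suc N)"
        using that by (auto intro!: divide_left_mono)
      then have "(norm (v m - v n))\<^sup>2 < e\<^sup>2"
        using para[of m n] N by simp
      then show ?thesis
        using \<open>e > 0\<close> unfolding dist_norm by (auto intro: power2_less_imp_less[of _ e])
    qed
    then show "\<exists>M. \<forall>m\<ge>M. \<forall>n\<ge>M. dist (v m) (v n) < e" by blast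
  qed
  then obtain l where l: "v \<longlonglongrightarrow> l"
    using convergent_eq_Cauchy by blast
  have lV: "l \<in> V"
    using closed_sequentially[OF assms(2)] v(1) l by blast
  have "(\<lambda>n. (norm (x - v n))\<^sup>2) \<longlonglongrightarrow> (norm (x - l))\<^sup>2"
    by (intro tendsto_intros l)
  moreover have "(\<lambda>n. d\<^sup>2 + 1 / real (Suc n)) \<longlonglongrightarrow> d\<^sup>2 + 0"
    by (intro tendsto_intros LIMSEQ_Suc[OF lim_const_over_n])
  ultimately have l_le: "(norm (x - l))\<^sup>2 \<le> d\<^sup>2"
    using v(2) by (intro LIMSEQ_le[of _ _ _ "d\<^sup>2"]) (auto intro: less_imp_le)
  show thesis
  proof (rule that[OF lV])
    fix w assume w: "w \<in> V"
    show "(x - l) \<bullet> w = 0"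
    proof (cases "w = 0")
      case False
      \<comment> \<open>The minimiser of the squared distance from \<open>x\<close> to
        \<open>l + t w\<close>; if the inner product with \<open>w\<close> were nonzero, that point
        would be strictly closer to \<open>x\<close> than \<open>l\<close>.\<close>
      define t where "t = (x - l) \<bullet> w / (w \<bullet> w)"
      have "l + t *\<^sub>R w \<in> V" using lV w assms(1) by (simp add: subspace_add subspace_scale)
      from order_trans[OF l_le d_le[OF this]]
      have "(x - l) \<bullet> (x - l) \<le> (x - l) \<bullet> (x - l) - 2 * t * ((x - l) \<bullet> w) + t\<^sup>2 * (w \<bullet> w)"
        unfolding power2_norm_eq_inner by (simp add: algebra_simps inner_commute power2_eq_square)
      then have "2 * t * ((x - l) \<bullet> w) \<le> t\<^sup>2 * (w \<bullet> w)" by simp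
      then have "((x - l) \<bullet> w)\<^sup>2 / (w \<bullet> w) \<le> 0"
        using False by (simp add: t_def power2_eq_square field_simps)
      moreover have "w \<bullet> w > 0" using False by simp
      ultimately have "((x - l) \<bullet> w)\<^sup>2 \<le> 0"
        by (simp only: divide_le_0_iff) auto
      then show ?thesis by simp
    qed auto
  qed
qed

lemma (in real_inner) inner_norm_bound_imp:
  fixes x :: 'a assumes "e > 0" "e * (x \<bullet> x) \<le> y \<bullet> x"
  shows "e * norm x \<le> norm y"
proof (cases "x = 0")
  case False
  have "(e * norm x) * norm x \<le> y \<bullet> x"
    using assms(2) by (simp add: local.dot_square_norm power2_eq_square)
  also have "\<dots> \<le> norm y * norm x"
    by (rule local.norm_cauchy_schwarz)
  finally show ?thesis
    using False by simp
qed simp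

context hilbert_space
begin

section \<open>Scalars and the scalar-valued inner product\<close>

lemma of_real_in_F [simp]: "complex_of_real r \<in> F"
  using scalars by auto

lemma F_closed [simp]:
  "c \<in> F \<Longrightarrow> d \<in> F \<Longrightarrow> c + d \<in> F" "c \<in> F \<Longrightarrow> d \<in> F \<Longrightarrow> c * d \<in> F"
  "c \<in> F \<Longrightarrow> - c \<in> F" "c \<in> F \<Longrightarrow> cnj c \<in> F" "0 \<in> F" "1 \<in> F"
  using scalars by (auto simp: Reals_cnj_iff)

lemma scale_zero_right [simp]: "c \<in> F \<Longrightarrow> scale H c 0 = 0"
  using scale_add_right[of c 0 0] by simp

lemma scale_minus_right: "c \<in> F \<Longrightarrow> scale H c (- x) = - scale H c x"
  using scale_add_right[of c x "- x"] by (simp add: eq_neg_iff_add_eq_0 add.commute)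

lemma scale_diff_right: "c \<in> F \<Longrightarrow> scale H c (x - y) = scale H c x - scale H c y"
  using scale_add_right[of c x "- y"] by (simp add: scale_minus_right)

lemma scale_scaleR: "c \<in> F \<Longrightarrow> scale H c (r *\<^sub>R x) = r *\<^sub>R scale H c x"
  using scale_scale[of c "of_real r" x] scale_scale[of "of_real r" c x]
  by (simp add: scale_of_real mult.commute)

lemma scale_simps [simp]: "scale H 0 x = 0" "scale H 1 x = x" "scale H (- 1) x = - x"
  using scale_of_real[of 0 x] scale_of_real[of 1 x] scale_of_real[of "- 1" x] by auto

lemma ip_self: "ip H x x = of_real ((norm x)\<^sup>2)"
proof (rule complex_eqI)
  have "Im (ip H x x) = Im (cnj (ip H x x))"
    using ip_commute[of x x] by simp
  then show "Im (ip H x x) = Im (of_real ((norm x)\<^sup>2))" by simp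
qed (simp add: Re_ip power2_norm_eq_inner)

lemma ip_scale_right: "c \<in> F \<Longrightarrow> ip H x (scale H c y) = cnj c * ip H x y"
  by (subst (1 2) ip_commute) (simp add: ip_scale_left)

lemma ip_scaleR_left: "ip H (r *\<^sub>R x) y = of_real r * ip H x y"
  using ip_scale_left[of "of_real r" x y] by (simp add: scale_of_real)

lemma ip_zero_left [simp]: "ip H 0 y = 0"
  using ip_add_left[of 0 0 y] by simp

lemma ip_zero_right [simp]: "ip H y 0 = 0"
  using ip_commute[of 0 y] by simp

lemma ip_minus_left: "ip H (- x) y = - ip H x y"
  using ip_add_left[of x "- x" y] by (simp add: eq_neg_iff_add_eq_0 add.commute)

lemma ip_diff_left: "ip H (x - y) z = ip H x z - ip H y z"
  using ip_add_left[of x "- y" z] by (simp add: ip_minus_left)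

lemma norm_scale: assumes "c \<in> F" shows "norm (scale H c x) = cmod c * norm x"
proof -
  have "complex_of_real ((norm (scale H c x))\<^sup>2) = of_real ((cmod c * norm x)\<^sup>2)"
    using assms
    by (simp add: ip_self[symmetric] ip_scale_left ip_scale_right power_mult_distrib
        complex_norm_square mult.assoc del: of_real_power)
  then have "(norm (scale H c x))\<^sup>2 = (cmod c * norm x)\<^sup>2"
    by (simp only: of_real_eq_iff)
  then show ?thesis
    by (simp add: power2_eq_iff_nonneg)
qed

lemma scale_inner: "c \<in> F \<Longrightarrow> scale H c x \<bullet> y = x \<bullet> scale H (cnj c) y"
  by (simp flip: Re_ip add: ip_scale_left ip_scale_right)

text \<open>Multiplying \<open>x\<close> by the conjugate of \<open>ip H x y\<close> makes the inner
  product real and nonnegative, so that Cauchy-Schwarz for the real inner product applies.\<close>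

lemma norm_ip_le: "cmod (ip H x y) \<le> norm x * norm y"
proof (cases "ip H x y = 0")
  case False
  define c where "c = cnj (ip H x y)"
  have c: "c \<in> F" by (simp add: c_def ip_scalar)
  have "(cmod c)\<^sup>2 = Re (ip H (scale H c x) y)"
    using c complex_mult_cnj[of "ip H x y"]
    by (simp add: ip_scale_left c_def cmod_def power2_eq_square)
  also have "\<dots> \<le> cmod c * norm x * norm y"
    using norm_cauchy_schwarz[of "scale H c x" y] c by (simp add: Re_ip norm_scale)
  finally show ?thesis using False by (simp add: power2_eq_square c_def mult.assoc)
qed simp

text \<open>Over the complex numbers \<open>c = \<i>\<close> reads off the imaginary part; over the
  reals it vanishes. This carries identities of the real inner product over to
  \<open>ip\<close>.\<close>

lemma ip_eqI:
  assumes "\<And>c. c \<in> F \<Longrightarrow> scale H c x \<bullet> y = scale H c u \<bullet> v"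
  shows "ip H x y = ip H u v"
proof -
  have *: "Re (c * ip H x y) = Re (c * ip H u v)" if "c \<in> F" for c
    using assms[OF that] that by (simp flip: Re_ip add: ip_scale_left)
  have "Im (ip H x y) = Im (ip H u v)"
  proof (cases "F = UNIV")
    case True
    then show ?thesis using *[of \<i>] by simp
  next
    case False
    then have "ip H x y \<in> \<real>" "ip H u v \<in> \<real>"
      using scalars ip_scalar by auto
    then show ?thesis by (simp add: complex_is_Real_iff)
  qed
  with *[of 1] show ?thesis by (simp add: complex_eq_iff)
qed

section \<open>Bounded operators and adjoints\<close>

lemma bounded_opsD:
  assumes "A \<in> bounded_ops F H"
  shows "bounded_linear A" "c \<in> F \<Longrightarrow> A (scale H c x) = scale H c (A x)"
  using assms by (auto simp: bounded_ops_def)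

lemma bounded_ops_linear:
  assumes "A \<in> bounded_ops F H"
  shows "A (x + y) = A x + A y" "A (x - y) = A x - A y" "A (r *\<^sub>R x) = r *\<^sub>R A x" "A 0 = 0"
    "A (- x) = - A x" "A (sum f I) = (\<Sum>i\<in>I. A (f i))"
proof -
  interpret A: bounded_linear A using assms by (rule bounded_opsD)
  show "A (x + y) = A x + A y" "A (x - y) = A x - A y" "A (r *\<^sub>R x) = r *\<^sub>R A x" "A 0 = 0"
    "A (- x) = - A x" "A (sum f I) = (\<Sum>i\<in>I. A (f i))"
    by (simp_all add: A.add A.diff A.scaleR A.zero A.neg A.sum)
qed

lemma bounded_ops_bound:
  assumes "A \<in> bounded_ops F H"
  obtains K where "K > 0" "\<And>x. norm (A x) \<le> K * norm x"
  using bounded_linear.pos_bounded[OF bounded_opsD(1)[OF assms]] by (auto simp: mult.commute)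

lemma bounded_opsI:
  assumes "\<And>x y. A (x + y) = A x + A y" "\<And>c x. c \<in> F \<Longrightarrow> A (scale H c x) = scale H c (A x)"
    "\<And>x. norm (A x) \<le> norm x * K"
  shows "A \<in> bounded_ops F H"
  using assms(1,3) assms(2)[OF of_real_in_F]
  by (auto simp: bounded_ops_def scale_of_real assms(2) intro!: bounded_linear_intro[where K = K])

lemma bounded_ops_intros [intro, simp]:
  "A \<in> bounded_ops F H \<Longrightarrow> B \<in> bounded_ops F H \<Longrightarrow> (\<lambda>x. A x + B x) \<in> bounded_ops F H"
  "A \<in> bounded_ops F H \<Longrightarrow> B \<in> bounded_ops F H \<Longrightarrow> (\<lambda>x. A x - B x) \<in> bounded_ops F H"
  "A \<in> bounded_ops F H \<Longrightarrow> B \<in> bounded_ops F H \<Longrightarrow> (\<lambda>x. A (B x)) \<in> bounded_ops F H"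
  "A \<in> bounded_ops F H \<Longrightarrow> (\<lambda>x. r *\<^sub>R A x) \<in> bounded_ops F H"
  "(\<lambda>x. x) \<in> bounded_ops F H"
  "(\<lambda>x. 0) \<in> bounded_ops F H"
  by (auto simp: bounded_ops_def bounded_linear_add bounded_linear_sub bounded_linear_compose
      scale_add_right scale_diff_right scale_scaleR bounded_linear_ident
      bounded_linear_scaleR_right
      intro: bounded_linear_const_scaleR)

lemma bounded_ops_sum [intro, simp]:
  "(\<And>i. i \<in> I \<Longrightarrow> A i \<in> bounded_ops F H) \<Longrightarrow> (\<lambda>x. \<Sum>i\<in>I. A i x) \<in> bounded_ops F H"
  by (induction I rule: infinite_finite_induct) auto

text \<open>\<open>A\<close> commutes with scalars, so the real identity at
  \<open>scale H c x\<close> is the one that \<open>ip_eqI\<close> asks for. Adjoints can then be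
  handled with the real inner product.\<close>

lemma is_adjoint_iff:
  assumes "A \<in> bounded_ops F H"
  shows "is_adjoint H A B \<longleftrightarrow> (\<forall>x y. A x \<bullet> y = x \<bullet> B y)"
proof
  assume *: "\<forall>x y. A x \<bullet> y = x \<bullet> B y"
  have "ip H (A x) y = ip H x (B y)" for x y
    by (rule ip_eqI) (metis * assms bounded_opsD(2))
  then show "is_adjoint H A B" by (simp add: is_adjoint_def)
qed (metis Re_ip is_adjoint_def)

section \<open>Orthogonal projections\<close>

lemma projections_iff:
  "P \<in> projections F H \<longleftrightarrow>
     P \<in> bounded_ops F H \<and> (\<forall>x. P (P x) = P x) \<and> (\<forall>x y. P x \<bullet> y = x \<bullet> P y)"
  by (auto simp: projections_def fun_eq_iff is_adjoint_iff)

lemma projectionsD: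
  assumes "P \<in> projections F H"
  shows "P \<in> bounded_ops F H" "P (P x) = P x" "P x \<bullet> y = x \<bullet> P y" "ip H (P x) y = ip H x (P y)"
    "x \<in> range P \<longleftrightarrow> P x = x"
proof -
  show PP: "P (P x) = P x" for x
    using assms by (auto simp: projections_iff)
  show "P \<in> bounded_ops F H" "P x \<bullet> y = x \<bullet> P y"
    using assms unfolding projections_iff by blast+
  show "ip H (P x) y = ip H x (P y)"
    using assms unfolding projections_def is_adjoint_def by blast
  show "x \<in> range P \<longleftrightarrow> P x = x"
    using PP[of x] by (metis PP rangeE rangeI)
qed

lemma projection_norm_sq: "P \<in> projections F H \<Longrightarrow> P x \<bullet> x = (norm (P x))\<^sup>2"
  using projectionsD(3)[of P "P x" x]
  by (simp add: power2_norm_eq_inner projectionsD(2))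

lemma projection_norm_le: assumes "P \<in> projections F H" shows "norm (P x) \<le> norm x"
proof -
  have "norm (P x) * norm (P x) \<le> norm (P x) * norm x"
    using norm_cauchy_schwarz[of "P x" x] projection_norm_sq[OF assms, of x]
    by (simp add: power2_eq_square)
  then show ?thesis by (cases "P x = 0") auto
qed

lemma bounded_ops_continuous: "A \<in> bounded_ops F H \<Longrightarrow> continuous_on S A"
  by (simp add: bounded_opsD(1) linear_continuous_on)

lemma bounded_ops_tendsto: "A \<in> bounded_ops F H \<Longrightarrow> (f \<longlongrightarrow> l) G \<Longrightarrow> ((\<lambda>n. A (f n)) \<longlongrightarrow> A l) G"
  by (rule bounded_linear.tendsto[OF bounded_opsD(1)])

lemma projection_range:
  assumes "P \<in> projections F H"
  shows "is_subspace F H (range P)" "closed (range P)"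
proof -
  have r: "range P = {x. P x = x}" using projectionsD(5)[OF assms] by blast
  have P: "P \<in> bounded_ops F H" by (rule projectionsD(1)[OF assms])
  show "is_subspace F H (range P)"
    using P by (auto simp: is_subspace_def r bounded_ops_linear bounded_opsD(2))
  show "closed (range P)"
    unfolding r by (rule closed_Collect_eq) (auto intro: bounded_ops_continuous[OF P] continuous_on_id)
qed

lemma is_subspace_real: "is_subspace F H V \<Longrightarrow> subspace V"
  unfolding is_subspace_def subspace_def by (metis of_real_in_F scale_of_real)

text \<open>The nearest-point map is the projection. Its value at \<open>x\<close> is the only
  \<open>v \<in> V\<close> with \<open>x - v\<close> orthogonal to \<open>V\<close>; additivity and
  homogeneity follow by checking this property for the candidate values.\<close>

lemma closed_subspace_projection:
  assumes "is_subspace F H V" "closed V"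
  obtains Q where "Q \<in> projections F H" "range Q = V"
proof -
  have sV: "subspace V" using assms(1) by (rule is_subspace_real)
  have "\<exists>v\<in>V. \<forall>w\<in>V. (x - v) \<bullet> w = 0" for x
    by (rule nearest_point[OF sV assms(2), of x]) blast
  then obtain Q where Q: "\<And>x. Q x \<in> V" "\<And>x w. w \<in> V \<Longrightarrow> (x - Q x) \<bullet> w = 0"
    by metis
  have uniq: "Q x = v" if "v \<in> V" "\<And>w. w \<in> V \<Longrightarrow> (x - v) \<bullet> w = 0" for x v
  proof -
    have "Q x - v \<in> V" using Q that sV by (simp add: subspace_diff)
    then have "(x - v) \<bullet> (Q x - v) - (x - Q x) \<bullet> (Q x - v) = 0" using Q that by simp
    then have "(Q x - v) \<bullet> (Q x - v) = 0"
      by (simp flip: inner_diff_left)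
    then show ?thesis by simp
  qed
  have QV: "Q v = v" if "v \<in> V" for v using that by (intro uniq) auto
  have sym: "Q x \<bullet> y = x \<bullet> Q y" for x y
    using Q(2)[OF Q(1), of x y] Q(2)[OF Q(1), of y x] by (simp add: inner_diff_left inner_diff_right inner_commute)
  have bd: "norm (Q x) \<le> norm x * 1" for x
  proof -
    have "norm (Q x) * norm (Q x) = x \<bullet> Q x"
      using Q(2)[OF Q(1), of x x] by (simp add: inner_diff_left power2_norm_eq_inner flip: power2_eq_square)
    also have "\<dots> \<le> norm x * norm (Q x)" by (rule norm_cauchy_schwarz)
    finally show ?thesis by (cases "Q x = 0") auto
  qed
  have "Q \<in> bounded_ops F H"
  proof (rule bounded_opsI[OF _ _ bd])
    show "Q (x + y) = Q x + Q y" for x y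
    proof (rule uniq)
      show "(x + y - (Q x + Q y)) \<bullet> w = 0" if "w \<in> V" for w
        using Q(2)[OF that, of x] Q(2)[OF that, of y] by (simp add: algebra_simps)
    qed (use sV Q in \<open>simp add: subspace_add\<close>)
    show "Q (scale H c x) = scale H c (Q x)" if c: "c \<in> F" for c x
    proof (rule uniq)
      show "(scale H c x - scale H c (Q x)) \<bullet> w = 0" if w: "w \<in> V" for w
      proof -
        have "scale H (cnj c) w \<in> V" using assms(1) c w by (simp add: is_subspace_def)
        then show ?thesis
          using c by (simp add: scale_diff_right[symmetric] scale_inner Q)
      qed
    qed (use assms(1) Q c in \<open>simp add: is_subspace_def\<close>)
  qed
  then have "Q \<in> projections F H"
    using sym QV Q(1) by (simp add: projections_iff)
  moreover have "range Q = V" using Q(1) QV by (metis rangeI subsetI subset_antisym image_subsetI)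
  ultimately show thesis by (rule that)
qed

text \<open>Lax-Milgram: \<open>A x = y\<close> is a fixed point problem for
  \<open>x \<mapsto> x - t (A x - y)\<close>, a contraction for suitable \<open>t\<close>. The
  inverse is linear over \<open>F\<close> because \<open>A\<close> is injective, and bounded by
  \<open>1 / e\<close> because \<open>A\<close> is coercive.\<close>

lemma coercive_inverse:
  assumes A: "A \<in> bounded_ops F H" and e: "e > 0" "\<And>x. e * (x \<bullet> x) \<le> A x \<bullet> x"
  obtains G where "G \<in> bounded_ops F H" "\<And>x. A (G x) = x" "\<And>x. G (A x) = x"
proof -
  obtain K0 where K0: "K0 > 0" "\<And>x. norm (A x) \<le> K0 * norm x"
    using bounded_ops_bound[OF A] by blast
  \<comment> \<open>Enlarged beyond \<open>K0\<close> to have \<open>e < K\<close>, which keeps the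
    factor \<open>q\<close> below positive.\<close>
  define K where "K = K0 + e"
  have K: "K > 0" "e < K" "\<And>x. norm (A x) \<le> K * norm x"
    using K0 e(1) by (auto simp: K_def algebra_simps add_increasing2)
  have below: "e * norm x \<le> norm (A x)" for x
    by (rule inner_norm_bound_imp[OF e])
  have surj: "\<exists>x. A x = y" for y
  proof -
    \<comment> \<open>\<open>t = e / K\<^sup>2\<close> minimises
      \<open>1 - 2 t e + t\<^sup>2 K\<^sup>2\<close>, and \<open>q\<close> is the minimum.\<close>
    define t where "t = e / K\<^sup>2"
    define q where "q = 1 - e\<^sup>2 / K\<^sup>2"
    have t: "t > 0" using e K by (simp add: t_def)
    have "e\<^sup>2 < K\<^sup>2" using e K by (intro power_strict_mono) auto
    then have q: "0 < q" "q < 1" using K e by (auto simp: q_def)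
    have contr: "norm (z - t *\<^sub>R A z) \<le> sqrt q * norm z" for z
    proof -
      have "(norm (z - t *\<^sub>R A z))\<^sup>2 = z \<bullet> z - 2 * t * (A z \<bullet> z) + t\<^sup>2 * (norm (A z))\<^sup>2"
        unfolding power2_norm_eq_inner by (simp add: algebra_simps inner_commute power2_eq_square)
      also have "\<dots> \<le> z \<bullet> z - 2 * t * (e * (z \<bullet> z)) + t\<^sup>2 * (K * norm z)\<^sup>2"
        using t K(3)[of z] e(2)[of z] by (intro add_mono diff_mono mult_left_mono power_mono) auto
      also have "\<dots> = q * (z \<bullet> z)"
        using K unfolding power_mult_distrib power2_norm_eq_inner
        by (simp add: t_def q_def field_simps power2_eq_square)
      also have "\<dots> = (sqrt q * norm z)\<^sup>2"
        using q by (simp add: power_mult_distrib power2_norm_eq_inner)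
      finally show ?thesis by (rule power2_le_imp_le) (use q in auto)
    qed
    define f where "f x = x - t *\<^sub>R (A x - y)" for x
    have "\<exists>!x. f x = x"
    proof (rule banach_fix_type)
      show "\<forall>x y. dist (f x) (f y) \<le> sqrt q * dist x y"
      proof (intro allI)
        fix u v
        have "f u - f v = (u - v) - t *\<^sub>R A (u - v)"
          using A by (simp add: f_def bounded_ops_linear algebra_simps)
        then show "dist (f u) (f v) \<le> sqrt q * dist u v"
          using contr[of "u - v"] by (simp add: dist_norm)
      qed
    qed (use q in auto)
    then obtain x where "f x = x" by blast
    then have "A x = y" using t by (simp add: f_def)
    then show ?thesis ..
  qed
  have inj: "x = y" if "A x = A y" for x y
    using below[of "x - y"] that A e(1) by (simp add: bounded_ops_linear mult_le_0_iff)
  obtain G where G: "\<And>y. A (G y) = y" using surj by metis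
  have GA: "G (A x) = x" for x using G inj by blast
  have "G \<in> bounded_ops F H"
  proof (rule bounded_opsI[where K = "1 / e"])
    show "G (x + y) = G x + G y" for x y
      by (rule inj) (simp add: G bounded_ops_linear[OF A])
    show "G (scale H c x) = scale H c (G x)" if "c \<in> F" for c x
      by (rule inj) (simp add: G bounded_opsD(2)[OF A that])
    show "norm (G x) \<le> norm x * (1 / e)" for x
      using below[of "G x"] e(1) by (simp add: G field_simps)
  qed
  then show thesis using G GA that by blast
qed

end

section \<open>Compact operators\<close>

text \<open>A finite net for \<open>S\<close> of radius \<open>e/2\<close> covers the closure once
  its open balls are replaced by closed ones, and these lie in the balls of radius
  \<open>e\<close>.\<close>

lemma compact_closure_iff_totally_bounded:
  fixes S :: "'a::complete_space set"
  shows "compact (closure S) \<longleftrightarrow> (\<forall>e>0. \<exists>k. finite k \<and> S \<subseteq> (\<Union>x\<in>k. ball x e))"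
proof
  assume "compact (closure S)"
  then show "\<forall>e>0. \<exists>k. finite k \<and> S \<subseteq> (\<Union>x\<in>k. ball x e)"
    unfolding compact_eq_totally_bounded using closure_subset[of S] by (meson subset_trans)
next
  assume *: "\<forall>e>0. \<exists>k. finite k \<and> S \<subseteq> (\<Union>x\<in>k. ball x e)"
  show "compact (closure S)"
    unfolding compact_eq_totally_bounded
  proof (intro conjI allI impI)
    show "complete (closure S)" by (simp add: complete_eq_closed)
    fix e :: real assume "e > 0"
    then obtain k where k: "finite k" "S \<subseteq> (\<Union>x\<in>k. ball x (e/2))"
      using * by (meson half_gt_zero)
    have "(\<Union>x\<in>k. ball x (e/2)) \<subseteq> (\<Union>x\<in>k. cball x (e/2))" by auto
    moreover have "closed (\<Union>x\<in>k. cball x (e/2))" using k(1) by auto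
    ultimately have "closure S \<subseteq> (\<Union>x\<in>k. cball x (e/2))"
      using k(2) by (intro closure_minimal) auto
    also have "\<dots> \<subseteq> (\<Union>x\<in>k. ball x e)" using \<open>e > 0\<close> by fastforce
    finally show "\<exists>k. finite k \<and> closure S \<subseteq> (\<Union>x\<in>k. ball x e)" using k(1) by blast
  qed
qed

lemma compact_closure_subset:
  fixes S K :: "'a::metric_space set"
  assumes "compact K" "S \<subseteq> K" shows "compact (closure S)"
  by (metis assms closed_closure closure_minimal compact_Int_closed compact_imp_closed inf_absorb2)

context hilbert_space
begin

lemma compact_ops_iff:
  "A \<in> compact_ops F H \<longleftrightarrow> A \<in> bounded_ops F H \<and>
     (\<forall>e>0. \<exists>k. finite k \<and> (\<forall>x. norm x \<le> 1 \<longrightarrow> (\<exists>y\<in>k. norm (A x - y) < e)))"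
proof -
  have "A ` cball 0 1 \<subseteq> (\<Union>y\<in>k. ball y e) \<longleftrightarrow> (\<forall>x. norm x \<le> 1 \<longrightarrow> (\<exists>y\<in>k. norm (A x - y) < e))"
    for k e by (auto simp: image_subset_iff dist_norm norm_minus_commute)
  then show ?thesis
    by (simp add: compact_ops_def compact_closure_iff_totally_bounded)
qed

lemma compact_ops_bounded: "A \<in> compact_ops F H \<Longrightarrow> A \<in> bounded_ops F H"
  by (simp add: compact_ops_def)

lemma compact_ops_add:
  assumes "A \<in> compact_ops F H" "B \<in> compact_ops F H"
  shows "(\<lambda>x. A x + B x) \<in> compact_ops F H"
  unfolding compact_ops_iff
proof (intro conjI allI impI)
  show "(\<lambda>x. A x + B x) \<in> bounded_ops F H"
    using assms by (auto simp: compact_ops_bounded)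
  fix e :: real assume "e > 0"
  then have e: "e / 2 > 0" by simp
  obtain k where k: "finite k" "\<And>x. norm x \<le> 1 \<Longrightarrow> \<exists>y\<in>k. norm (A x - y) < e/2"
    using assms(1) e unfolding compact_ops_iff by meson
  obtain l where l: "finite l" "\<And>x. norm x \<le> 1 \<Longrightarrow> \<exists>y\<in>l. norm (B x - y) < e/2"
    using assms(2) e unfolding compact_ops_iff by meson
  have "\<exists>y\<in>(\<lambda>(a, b). a + b) ` (k \<times> l). norm (A x + B x - y) < e" if x: "norm x \<le> 1" for x
  proof -
    obtain a b where ab: "a \<in> k" "norm (A x - a) < e/2" "b \<in> l" "norm (B x - b) < e/2"
      using k(2)[OF x] l(2)[OF x] by blast
    have "norm ((A x - a) + (B x - b)) < e"
      using norm_triangle_ineq[of "A x - a" "B x - b"] ab by linarith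
    then show ?thesis using ab by (intro bexI[of _ "a + b"]) (auto simp: algebra_simps)
  qed
  then show "\<exists>k. finite k \<and> (\<forall>x. norm x \<le> 1 \<longrightarrow> (\<exists>y\<in>k. norm (A x + B x - y) < e))"
    using k(1) l(1) by (intro exI[of _ "(\<lambda>(a, b). a + b) ` (k \<times> l)"]) auto
qed

text \<open>Closedness under norm limits, with the pointwise bound expressing closeness in operator
  norm: an \<open>e/2\<close>-net for the image of the unit ball under a nearby \<open>K\<close> is
  an \<open>e\<close>-net for its image under \<open>T\<close>.\<close>

lemma compact_ops_limit:
  assumes "T \<in> bounded_ops F H"
    and "\<And>c. c > 0 \<Longrightarrow> \<exists>K\<in>compact_ops F H. \<forall>x. norm (T x - K x) \<le> c * norm x"
  shows "T \<in> compact_ops F H"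
  unfolding compact_ops_iff
proof (intro conjI allI impI assms(1))
  fix e :: real assume "e > 0"
  then have e: "e / 2 > 0" by simp
  obtain K where K: "K \<in> compact_ops F H" "\<And>x. norm (T x - K x) \<le> e/2 * norm x"
    using assms(2)[OF e] by blast
  obtain k where k: "finite k" "\<And>x. norm x \<le> 1 \<Longrightarrow> \<exists>y\<in>k. norm (K x - y) < e/2"
    using K(1) e unfolding compact_ops_iff by meson
  have "\<exists>y\<in>k. norm (T x - y) < e" if x: "norm x \<le> 1" for x
  proof -
    obtain y where y: "y \<in> k" "norm (K x - y) < e/2" using k(2)[OF x] by blast
    have "e/2 * norm x \<le> e/2" using x e by (simp add: mult_left_le)
    moreover have "norm (T x - y) \<le> norm (T x - K x) + norm (K x - y)"
      using norm_triangle_ineq[of "T x - K x" "K x - y"] by simp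
    ultimately show ?thesis using y K(2)[of x] by force
  qed
  then show "\<exists>k. finite k \<and> (\<forall>x. norm x \<le> 1 \<longrightarrow> (\<exists>y\<in>k. norm (T x - y) < e))"
    using k(1) by blast
qed

lemma compact_ops_compose_left:
  assumes "A \<in> bounded_ops F H" "K \<in> compact_ops F H"
  shows "(\<lambda>x. A (K x)) \<in> compact_ops F H"
proof -
  have comp: "compact (A ` closure (K ` cball 0 1))"
    using assms(2) by (intro compact_continuous_image bounded_ops_continuous assms(1))
      (simp add: compact_ops_def)
  have "(\<lambda>x. A (K x)) ` cball 0 1 \<subseteq> A ` closure (K ` cball 0 1)"
    using closure_subset[of "K ` cball 0 1"] by auto
  with comp have "compact (closure ((\<lambda>x. A (K x)) ` cball 0 1))"
    by (rule compact_closure_subset)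
  then show ?thesis
    using assms by (simp add: compact_ops_def)
qed

text \<open>The contraction bound, which projections satisfy, keeps the unit ball inside
  itself.\<close>

lemma compact_ops_compose_right:
  assumes "K \<in> compact_ops F H" "A \<in> bounded_ops F H" "\<And>x. norm (A x) \<le> norm x"
  shows "(\<lambda>x. K (A x)) \<in> compact_ops F H"
proof -
  have "(\<lambda>x. K (A x)) ` cball 0 1 \<subseteq> closure (K ` cball 0 1)"
  proof
    fix y assume "y \<in> (\<lambda>x. K (A x)) ` cball 0 1"
    then obtain x where x: "norm x \<le> 1" "y = K (A x)" by auto
    then have "A x \<in> cball 0 1" using assms(3)[of x] by simp
    then show "y \<in> closure (K ` cball 0 1)" unfolding x(2) by (intro subsetD[OF closure_subset] imageI)
  qed
  then have "compact (closure ((\<lambda>x. K (A x)) ` cball 0 1))"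
    by (rule compact_closure_subset[rotated]) (use assms(1) in \<open>simp add: compact_ops_def\<close>)
  then show ?thesis
    using assms(1,2) by (simp add: compact_ops_def)
qed

text \<open>Pigeonhole: for a finite \<open>c/2\<close>-net, two images share a net point and are
  closer than \<open>c\<close>.\<close>

lemma compact_ops_separated:
  assumes "K \<in> compact_ops F H" "c > 0" "\<And>n::nat. norm (x n) \<le> 1"
    and sep: "\<And>m n. m < n \<Longrightarrow> c \<le> norm (K (x m) - K (x n))"
  shows False
proof -
  obtain k where k: "finite k" "\<And>z. norm z \<le> 1 \<Longrightarrow> \<exists>y\<in>k. norm (K z - y) < c/2"
    using assms(1,2) unfolding compact_ops_iff by (meson half_gt_zero)
  then have "\<forall>n. \<exists>y\<in>k. norm (K (x n) - y) < c/2"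
    using assms(3) by blast
  then obtain g where g: "\<And>n. g n \<in> k" "\<And>n. norm (K (x n) - g n) < c/2"
    by metis
  have "finite (range g)" using g(1) k(1) by (meson finite_subset image_subsetI)
  then have "\<not> inj g" using finite_imageD infinite_UNIV_nat by blast
  then obtain m n where mn: "m < n" "g m = g n"
    by (metis injI linorder_neqE_nat)
  have "norm (K (x m) - K (x n)) \<le> norm (K (x m) - g m) + norm (K (x n) - g n)"
    using norm_triangle_ineq4[of "K (x m) - g m" "K (x n) - g n"] mn by simp
  then show False using g(2)[of m] g(2)[of n] sep[OF mn(1)] by simp
qed

text \<open>The test for noncompactness used below. Orthonormal vectors are at distance
  \<open>sqrt 2\<close>; the cruder separation \<open>1\<close> is enough.\<close>

lemma compact_ops_not_fix_orthonormal:
  assumes "K \<in> compact_ops F H" "\<And>n::nat. K (e n) = e n" "\<And>n. norm (e n) = 1"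
    and "\<And>m n. m < n \<Longrightarrow> e m \<bullet> e n = 0"
  shows False
proof (rule compact_ops_separated[OF assms(1), of 1 e])
  fix m n :: nat assume mn: "m < n"
  have "1\<^sup>2 \<le> (norm (e m - e n))\<^sup>2"
    unfolding power2_norm_eq_inner
    using assms(4)[OF mn] power2_norm_eq_inner[of "e m"] power2_norm_eq_inner[of "e n"]
    by (simp add: inner_diff_left inner_diff_right inner_commute assms(3))
  then show "1 \<le> norm (K (e m) - K (e n))"
    using power2_le_imp_le[of 1 "norm (e m - e n)"] by (simp add: assms(2))
qed (auto simp: assms(3))

section \<open>Operators of finite rank\<close>

lemma closed_F: "closed F"
  using scalars closed_complex_Reals by auto

lemma continuous_on_scale: "continuous_on F (\<lambda>c. scale H c u)"
proof (rule continuous_onI)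
  fix c e assume c: "c \<in> F" and e: "(e::real) > 0"
  have "dist (scale H d u) (scale H c u) \<le> e" if "d \<in> F" "dist d c < e / (norm u + 1)" for d
  proof -
    have "scale H d u - scale H c u = scale H (d - c) u"
      using c that(1) scale_add_left[of "d - c" c u] F_closed(1)[of d "- c"] by simp
    then have "dist (scale H d u) (scale H c u) = cmod (d - c) * norm u"
      using c that(1) F_closed(1)[of d "- c"] by (simp add: dist_norm norm_scale)
    also have "\<dots> \<le> e / (norm u + 1) * (norm u + 1)"
      using that(2) e by (intro mult_mono) (auto simp: dist_norm)
    also have "\<dots> = e" by (simp add: add_nonneg_eq_0_iff)
    finally show ?thesis .
  qed
  then show "\<exists>d>0. \<forall>x'\<in>F. dist x' c < d \<longrightarrow> dist (scale H x' u) (scale H c u) \<le> e"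
    using e by (intro exI[of _ "e / (norm u + 1)"]) (auto simp: add_nonneg_pos)
qed

lemma rank_one_bounded: "(\<lambda>x. scale H (ip H x u) v) \<in> bounded_ops F H"
proof (rule bounded_opsI)
  fix x
  have "cmod (ip H x u) * norm v \<le> (norm x * norm u) * norm v"
    by (intro mult_right_mono norm_ip_le) auto
  then show "norm (scale H (ip H x u) v) \<le> norm x * (norm u * norm v)"
    by (simp add: norm_scale ip_scalar mult.assoc)
qed (simp_all add: ip_add_left scale_add_left ip_scalar ip_scale_left scale_scale)

lemma rank_one_compact: "(\<lambda>x. scale H (ip H x u) v) \<in> compact_ops F H"
proof -
  have "compact ((\<lambda>c. scale H c v) ` (F \<inter> cball 0 (norm u)))"
    by (intro compact_continuous_image continuous_on_subset[OF continuous_on_scale]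
        closed_Int_compact closed_F compact_cball) auto
  moreover have "(\<lambda>x. scale H (ip H x u) v) ` cball 0 1 \<subseteq> (\<lambda>c. scale H c v) ` (F \<inter> cball 0 (norm u))"
  proof
    fix z assume "z \<in> (\<lambda>x. scale H (ip H x u) v) ` cball 0 1"
    then obtain x where x: "norm x \<le> 1" "z = scale H (ip H x u) v" by auto
    have "cmod (ip H x u) \<le> norm x * norm u" by (rule norm_ip_le)
    also have "\<dots> \<le> norm u" using x(1) by (simp add: mult_left_le_one_le)
    finally show "z \<in> (\<lambda>c. scale H c v) ` (F \<inter> cball 0 (norm u))"
      using x(2) by (auto simp: ip_scalar)
  qed
  ultimately have "compact (closure ((\<lambda>x. scale H (ip H x u) v) ` cball 0 1))"
    by (rule compact_closure_subset)
  then show ?thesis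
    by (simp add: compact_ops_def rank_one_bounded)
qed

lemma rank_one_projection_inner:
  "scale H (ip H x u) u \<bullet> y = x \<bullet> scale H (ip H y u) u"
  using ip_commute[of y u]
  by (simp flip: Re_ip add: ip_scale_left ip_scale_right ip_scalar mult.commute)

lemma is_subspaceD:
  assumes "is_subspace F H V"
  shows "0 \<in> V" "x \<in> V \<Longrightarrow> y \<in> V \<Longrightarrow> x + y \<in> V" "x \<in> V \<Longrightarrow> y \<in> V \<Longrightarrow> x - y \<in> V"
    "c \<in> F \<Longrightarrow> x \<in> V \<Longrightarrow> scale H c x \<in> V" "x \<in> V \<Longrightarrow> r *\<^sub>R x \<in> V"
    "(\<And>i. i \<in> I \<Longrightarrow> f i \<in> V) \<Longrightarrow> sum f I \<in> V"
  using assms is_subspace_real[OF assms]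
  by (auto simp: is_subspace_def subspace_diff subspace_scale intro: subspace_sum)

text \<open>Gram-Schmidt, one vector at a time. The last property says that \<open>E\<close>
  projects onto the span of \<open>S\<close>, in a form that also applies to subspaces that are not
  closed, such as the algebraic sum.\<close>

lemma finite_rank_projection:
  assumes "finite S"
  obtains E where "E \<in> projections F H" "E \<in> compact_ops F H" "\<And>s. s \<in> S \<Longrightarrow> E s = s"
    "\<And>V. is_subspace F H V \<Longrightarrow> S \<subseteq> V \<Longrightarrow> range E \<subseteq> V"
proof -
  have "\<exists>E. E \<in> projections F H \<and> E \<in> compact_ops F H \<and> (\<forall>s\<in>S. E s = s) \<and>
    (\<forall>V. is_subspace F H V \<longrightarrow> S \<subseteq> V \<longrightarrow> range E \<subseteq> V)"
    using assms
  proof (induction S rule: finite_induct)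
    case empty
    show ?case
      by (intro exI[of _ "\<lambda>x. 0"])
        (auto simp: projections_iff compact_ops_iff is_subspace_def intro: exI[of _ "{0}"])
  next
    case (insert s S)
    then obtain E where E: "E \<in> projections F H" "E \<in> compact_ops F H" "\<forall>s\<in>S. E s = s"
      "\<And>V. is_subspace F H V \<Longrightarrow> S \<subseteq> V \<Longrightarrow> range E \<subseteq> V"
      by blast
    note EB = projectionsD(1)[OF E(1)]
    \<comment> \<open>The part of \<open>s\<close> orthogonal to the range of \<open>E\<close>. If
      it vanishes, \<open>E\<close> already fixes \<open>s\<close>; otherwise its normalisation
      contributes a rank one projection.\<close>
    define u0 where "u0 = s - E s"
    define u where "u = (1 / norm u0) *\<^sub>R u0"
    have Eu0: "E u0 = 0"
      using projectionsD(2)[OF E(1)] by (simp add: u0_def bounded_ops_linear[OF EB])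
    show ?case
    proof (cases "u0 = 0")
      case True
      then show ?thesis using E by (intro exI[of _ E]) (auto simp: u0_def)
    next
      case False
      have Eu: "E u = 0" using Eu0 by (simp add: u_def bounded_ops_linear[OF EB])
      have nu: "norm u = 1" using False by (simp add: u_def)
      have u0: "u0 = norm u0 *\<^sub>R u" using False by (simp add: u_def)
      have ipu: "ip H u u = 1" by (simp add: ip_self nu)
      have ipE: "ip H (E x) u = 0" for x
        using projectionsD(4)[OF E(1), of x u] by (simp add: Eu)
      define E' where "E' x = E x + scale H (ip H x u) u" for x
      have E'E': "E' (E' x) = E' x" for x
        unfolding E'_def
        by (simp add: bounded_ops_linear[OF EB] bounded_opsD(2)[OF EB] ip_scalar Eu
            projectionsD(2)[OF E(1)] ip_add_left ip_scale_left ipu ipE)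
      have sym: "E' x \<bullet> y = x \<bullet> E' y" for x y
        unfolding E'_def
        by (simp add: inner_add_left inner_add_right projectionsD(3)[OF E(1)]
            rank_one_projection_inner)
      have comp: "E' \<in> compact_ops F H"
        unfolding E'_def by (intro compact_ops_add E rank_one_compact)
      have "E' \<in> projections F H"
        using compact_ops_bounded[OF comp] E'E' sym by (simp add: projections_iff)
      moreover have "E' t = t" if t: "t \<in> insert s S" for t
      proof (cases "t = s")
        case True
        have "ip H s u = ip H u0 u"
          by (simp add: u0_def ip_diff_left ipE)
        also have "\<dots> = of_real (norm u0)"
          by (subst u0) (simp add: ip_scale_left ipu flip: scale_of_real)
        finally show ?thesis
          using True u0 by (simp add: E'_def scale_of_real) (simp add: u0_def)
      next
        case False
        then have "E t = t" using t E(3) by auto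
        then show ?thesis using ipE[of t] by (simp add: E'_def)
      qed
      moreover have "range E' \<subseteq> V" if V: "is_subspace F H V" "insert s S \<subseteq> V" for V
      proof -
        have "range E \<subseteq> V" using E(4) V by blast
        then have "u \<in> V" using V by (auto simp: u_def u0_def intro!: is_subspaceD[OF V(1)])
        then show ?thesis
          using \<open>range E \<subseteq> V\<close> by (auto simp: E'_def ip_scalar intro!: is_subspaceD[OF V(1)])
      qed
      ultimately show ?thesis using comp by blast
    qed
  qed
  then show thesis using that by blast
qed

lemma projection_diff:
  assumes "P \<in> projections F H" "Q \<in> projections F H" "range P \<subseteq> range Q"
  shows "(\<lambda>x. Q x - P x) \<in> projections F H" "Q (P x) = P x" "P (Q x) = P x"
proof -
  show QP: "Q (P x) = P x" for x
    using assms(3) projectionsD(5)[OF assms(2)] by blast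
  have "P (Q x) \<bullet> y = P x \<bullet> y" for x y
    using projectionsD(3)[OF assms(1)] projectionsD(3)[OF assms(2)] QP by metis
  then show PQ: "P (Q x) = P x" for x
    by (metis vector_eq_ldot inner_commute)
  show "(\<lambda>x. Q x - P x) \<in> projections F H"
    unfolding projections_iff using assms(1,2) QP PQ
    by (auto simp: projectionsD(2) bounded_ops_linear[OF projectionsD(1)] projectionsD(1)
        inner_diff_left inner_diff_right projectionsD(3))
qed

section \<open>Quotients of closed subspaces and compactness\<close>

lemma coset_eq_iff:
  assumes "is_subspace F H W"
  shows "(+) a ` W = (+) b ` W \<longleftrightarrow> a - b \<in> W"
proof
  assume "(+) a ` W = (+) b ` W"
  then have "a + 0 \<in> (+) b ` W" using is_subspaceD(1)[OF assms] by blast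
  then show "a - b \<in> W" by auto
next
  have *: "(+) a ` W \<subseteq> (+) b ` W" if "a - b \<in> W" for a b
  proof
    fix z assume "z \<in> (+) a ` W"
    then obtain w where "w \<in> W" "z = b + ((a - b) + w)" by auto
    then show "z \<in> (+) b ` W" using that is_subspaceD(2)[OF assms] by blast
  qed
  assume "a - b \<in> W"
  moreover from this have "b - a \<in> W"
    using is_subspaceD(3)[OF assms is_subspaceD(1)[OF assms], of "a - b"] by simp
  ultimately show "(+) a ` W = (+) b ` W" using * by blast
qed

lemma is_subspace_finite_span:
  assumes "finite B"
  shows "is_subspace F H {\<Sum>b\<in>B. scale H (c b) b | c. c \<in> B \<rightarrow> F}" (is "is_subspace F H ?V")
    and "B \<subseteq> {\<Sum>b\<in>B. scale H (c b) b | c. c \<in> B \<rightarrow> F}"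
proof -
  show "is_subspace F H ?V"
    unfolding is_subspace_def
  proof (intro conjI ballI)
    show "0 \<in> ?V" by (intro CollectI exI[of _ "\<lambda>_. 0"]) simp
  next
    fix x y assume "x \<in> ?V" "y \<in> ?V"
    then obtain c d where "c \<in> B \<rightarrow> F" "d \<in> B \<rightarrow> F"
      "x = (\<Sum>b\<in>B. scale H (c b) b)" "y = (\<Sum>b\<in>B. scale H (d b) b)" by blast
    then show "x + y \<in> ?V"
      by (intro CollectI exI[of _ "\<lambda>b. c b + d b"])
        (auto simp: Pi_iff scale_add_left simp flip: sum.distrib intro!: sum.cong)
  next
    fix a x assume a: "a \<in> F" and "x \<in> ?V"
    then obtain c where c: "c \<in> B \<rightarrow> F" "x = (\<Sum>b\<in>B. scale H (c b) b)" by blast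
    have "scale H a (\<Sum>b\<in>C. scale H (c b) b) = (\<Sum>b\<in>C. scale H (a * c b) b)" if "C \<subseteq> B" for C
      using finite_subset[OF that assms] that c a
      by (induction C rule: finite_induct) (auto simp: scale_add_right scale_scale Pi_iff)
    then show "scale H a x \<in> ?V"
      using c a by (intro CollectI exI[of _ "\<lambda>b. a * c b"]) (auto simp: Pi_iff)
  qed
  show "B \<subseteq> ?V"
  proof
    fix b assume b: "b \<in> B"
    have "(\<Sum>i\<in>B. scale H (if i = b then 1 else 0) i) = (\<Sum>i\<in>B. if i = b then b else 0)"
      by (rule sum.cong) auto
    then show "b \<in> ?V"
      using assms b by (intro CollectI exI[of _ "\<lambda>i. if i = b then 1 else 0"]) auto
  qed
qed

text \<open>\<open>D = Q - P\<close> projects onto the orthogonal complement of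
  \<open>range P\<close> in \<open>range Q\<close>, which represents the quotient, and a projection
  is compact exactly if its range is finite dimensional.\<close>

lemma infinite_dim_quotient_iff:
  assumes P: "P \<in> projections F H" and Q: "Q \<in> projections F H" and PQ: "range P \<subseteq> range Q"
  shows "infinite_dim_quotient F H (range Q) (range P) \<longleftrightarrow> (\<lambda>x. Q x - P x) \<notin> compact_ops F H"
proof -
  define D where "D = (\<lambda>x. Q x - P x)"
  have D: "D \<in> projections F H" unfolding D_def by (rule projection_diff(1)[OF P Q PQ])
  note DB = projectionsD(1)[OF D]
  note QP = projection_diff(2)[OF P Q PQ] and PQx = projection_diff(3)[OF P Q PQ]
  have DP: "D (P x) = 0" for x by (simp add: D_def QP projectionsD(2)[OF P])
  have rangeD: "D x \<in> range Q" for x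
    unfolding projectionsD(5)[OF Q] D_def
    by (simp add: bounded_ops_linear[OF projectionsD(1)[OF Q]] QP projectionsD(2)[OF Q])
  have coset_D: "(+) v ` range P = (+) (D v) ` range P" if "v \<in> range Q" for v
  proof -
    have "v - D v = P v" using that by (simp add: D_def projectionsD(5)[OF Q])
    then show ?thesis by (simp add: coset_eq_iff[OF projection_range(1)[OF P]])
  qed
  have "\<not> infinite_dim_quotient F H (range Q) (range P) \<longleftrightarrow> D \<in> compact_ops F H"
  proof
    assume "\<not> infinite_dim_quotient F H (range Q) (range P)"
    then obtain B where B: "finite B" "B \<subseteq> range Q"
      "\<And>X. X \<in> quotient_space (range Q) (range P) \<Longrightarrow>
         \<exists>c\<in>B \<rightarrow> F. X = (+) (\<Sum>b\<in>B. scale H (c b) b) ` range P"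
      unfolding infinite_dim_quotient_def by auto
    have "finite (D ` B)" using B(1) by simp
    then obtain E where E: "E \<in> projections F H" "E \<in> compact_ops F H"
      "\<And>s. s \<in> D ` B \<Longrightarrow> E s = s"
      by (rule finite_rank_projection) blast
    note EB = projectionsD(1)[OF E(1)]
    \<comment> \<open>\<open>D\<close> annihilates \<open>range P\<close>, so the images under
      \<open>D\<close> of the vectors in \<open>B\<close> span the range of \<open>D\<close>; hence
      \<open>E\<close> fixes that range.\<close>
    have "E (D x) = D x" for x
    proof -
      have "(+) (D x) ` range P \<in> quotient_space (range Q) (range P)"
        using rangeD by (auto simp: quotient_space_def)
      then obtain c where c: "c \<in> B \<rightarrow> F"
        "(+) (D x) ` range P = (+) (\<Sum>b\<in>B. scale H (c b) b) ` range P"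
        using B(3) by blast
      then obtain y where y: "D x - (\<Sum>b\<in>B. scale H (c b) b) = P y"
        unfolding coset_eq_iff[OF projection_range(1)[OF P]] by blast
      have "D (D x - (\<Sum>b\<in>B. scale H (c b) b)) = 0" unfolding y by (rule DP)
      then have "D x = D (\<Sum>b\<in>B. scale H (c b) b)"
        by (simp add: bounded_ops_linear(2)[OF DB] projectionsD(2)[OF D])
      also have "\<dots> = (\<Sum>b\<in>B. scale H (c b) (D b))"
        unfolding bounded_ops_linear(6)[OF DB]
        using c(1) by (intro sum.cong refl bounded_opsD(2)[OF DB]) auto
      finally have *: "D x = (\<Sum>b\<in>B. scale H (c b) (D b))" .
      have "E (\<Sum>b\<in>B. scale H (c b) (D b)) = (\<Sum>b\<in>B. scale H (c b) (D b))"
        unfolding bounded_ops_linear(6)[OF EB]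
      proof (rule sum.cong)
        fix b assume "b \<in> B"
        then show "E (scale H (c b) (D b)) = scale H (c b) (D b)"
          using c(1) E(3)[of "D b"] bounded_opsD(2)[OF EB, of "c b" "D b"] by auto
      qed simp
      then show ?thesis unfolding * .
    qed
    then have "D = (\<lambda>x. E (D x))" by simp
    then show "D \<in> compact_ops F H"
      using compact_ops_compose_right[OF E(2) DB projection_norm_le[OF D]] by simp
  next
    assume comp: "D \<in> compact_ops F H"
    show "\<not> infinite_dim_quotient F H (range Q) (range P)"
    proof
      assume inf: "infinite_dim_quotient F H (range Q) (range P)"
      \<comment> \<open>What the recursive choice has to supply: a unit vector in the range of
        \<open>D\<close>, orthogonal to all earlier ones.\<close>
      define R where "R f n x \<longleftrightarrow> D x = x \<and> norm x = 1 \<and> (\<forall>i<n. ip H x (f i) = 0)"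
        for f and n :: nat and x
      have "\<exists>f. \<forall>n. R f n (f n)"
      proof (rule dependent_wellorder_choice)
        fix n f assume f: "\<And>i. i < n \<Longrightarrow> R f i (f i)"
        obtain E where E: "E \<in> projections F H" "\<And>s. s \<in> f ` {..<n} \<Longrightarrow> E s = s"
          "\<And>V. is_subspace F H V \<Longrightarrow> f ` {..<n} \<subseteq> V \<Longrightarrow> range E \<subseteq> V"
          by (rule finite_rank_projection[of "f ` {..<n}"]) simp_all
        note EB = projectionsD(1)[OF E(1)]
        have DfB: "D b = b" if "b \<in> f ` {..<n}" for b using that f by (auto simp: R_def)
        \<comment> \<open>Otherwise the range of \<open>E\<close>, the span of the earlier vectors,
          would contain the range of \<open>D\<close>, and finitely many vectors would span the
          quotient.\<close>
        have "\<exists>x. E (D x) \<noteq> D x"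
        proof (rule ccontr)
          assume "\<nexists>x. E (D x) \<noteq> D x"
          then have ED: "E (D x) = D x" for x by blast
          have "\<exists>c\<in>f ` {..<n} \<rightarrow> F. X = (+) (\<Sum>b\<in>f ` {..<n}. scale H (c b) b) ` range P"
            if X: "X \<in> quotient_space (range Q) (range P)" for X
          proof -
            obtain v where v: "v \<in> range Q" "X = (+) (D v) ` range P"
              using X coset_D by (auto simp: quotient_space_def)
            have "D v \<in> {\<Sum>b\<in>f ` {..<n}. scale H (c b) b | c. c \<in> f ` {..<n} \<rightarrow> F}"
              using E(3)[OF is_subspace_finite_span(1) is_subspace_finite_span(2)] ED[of v]
              by (metis (no_types, lifting) finite_imageI finite_lessThan rangeI subset_iff)
            then obtain c where "c \<in> f ` {..<n} \<rightarrow> F" "D v = (\<Sum>b\<in>f ` {..<n}. scale H (c b) b)"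
              by blast
            then show ?thesis using v(2) by (intro bexI[of _ c]) simp_all
          qed
          moreover have "f ` {..<n} \<subseteq> range Q" using DfB rangeD by (metis subsetI)
          ultimately show False using inf unfolding infinite_dim_quotient_def
            by (meson finite_imageI finite_lessThan)
        qed
        then obtain x where x: "E (D x) \<noteq> D x" ..
        define y where "y = D x - E (D x)"
        have y0: "y \<noteq> 0" using x by (simp add: y_def)
        have "range E \<subseteq> range D"
          using E(3)[OF projection_range(1)[OF D]] DfB by (metis rangeI subsetI)
        then have Dy: "D y = y"
          using projectionsD(5)[OF D] by (auto simp: y_def bounded_ops_linear[OF DB] projectionsD(2)[OF D])
        have Ey: "E y = 0"
          by (simp add: y_def bounded_ops_linear[OF EB] projectionsD(2)[OF E(1)])
        have "ip H y (f i) = 0" if "i < n" for i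
          using projectionsD(4)[OF E(1), of y "f i"] E(2)[of "f i"] that Ey by simp
        then have "R f n ((1 / norm y) *\<^sub>R y)"
          using y0 Dy by (simp add: R_def bounded_ops_linear[OF DB] ip_scaleR_left)
        then show "\<exists>x. R f n x" ..
      qed (auto simp: R_def)
      then obtain f where "\<And>n. R f n (f n)" by blast
      then have f: "\<And>n. D (f n) = f n" "\<And>n. norm (f n) = 1" "\<And>m n. m < n \<Longrightarrow> ip H (f n) (f m) = 0"
        by (auto simp: R_def)
      show False
      proof (rule compact_ops_not_fix_orthonormal[OF comp, of f])
        show "f m \<bullet> f n = 0" if "m < n" for m n
          using f(3)[OF that] Re_ip[of "f n" "f m"] by (simp add: inner_commute)
      qed (simp_all add: f)
    qed
  qed
  then show ?thesis unfolding D_def by blast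
qed

end

section \<open>Algebraic sums of closed subspaces\<close>

text \<open>
  The witness is \<open>\<Sum>k. \<sigma>\<^sub>k 3\<^sup>-\<^sup>k z\<^sub>k / \<parallel>z\<^sub>k\<parallel>\<close>, where the signs \<open>\<sigma>\<^sub>k\<close> are chosen so that the
  \<open>k\<close>-th term does not cancel the previous ones against \<open>z\<^sub>k\<close>; the tail is half as big.
\<close>

lemma gliding_hump:
  fixes z :: "nat \<Rightarrow> 'a::{real_inner, complete_space}"
  assumes V: "subspace V" "closed V" "\<And>k. z k \<in> V"
  obtains y where "y \<in> V" "\<And>k. 1/2 * (1/3)^k * norm (z k) \<le> \<bar>y \<bullet> z k\<bar>"
proof -
  define \<sigma> :: "nat \<Rightarrow> 'a \<Rightarrow> real" where "\<sigma> k v = (if v \<bullet> z k \<ge> 0 then 1 else - 1)" for k v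
  define y where "y = rec_nat 0 (\<lambda>k v. v + (\<sigma> k v * (1/3)^k) *\<^sub>R sgn (z k))"
  have y0: "y 0 = 0" and ySuc: "y (Suc k) = y k + (\<sigma> k (y k) * (1/3)^k) *\<^sub>R sgn (z k)" for k
    by (simp_all add: y_def)
  have yV: "y k \<in> V" for k
    by (induction k) (auto simp: y0 ySuc sgn_div_norm V subspace_0 subspace_add subspace_scale)
  have step: "norm (y (Suc k) - y k) \<le> (1/3)^k" for k
    by (simp add: ySuc \<sigma>_def norm_sgn)
  have lower: "(1/3)^k * norm (z k) \<le> \<bar>y (Suc k) \<bullet> z k\<bar>" for k
  proof -
    have "sgn (z k) \<bullet> z k = norm (z k)"
      by (cases "z k = 0") (simp_all add: sgn_div_norm dot_square_norm power2_eq_square)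
    then have "y (Suc k) \<bullet> z k = y k \<bullet> z k + \<sigma> k (y k) * ((1/3)^k * norm (z k))"
      by (simp add: ySuc inner_add_left)
    moreover have "0 \<le> (1/3)^k * norm (z k)" by simp
    ultimately show ?thesis by (auto simp: \<sigma>_def)
  qed
  \<comment> \<open>The exact partial sum of the geometric series; without the last factor the bound
    would not carry the induction.\<close>
  have tail: "norm (y (n + j) - y n) \<le> 3/2 * (1/3)^n * (1 - (1/3)^j)" for n j
  proof (induction j)
    case (Suc j)
    have "norm (y (n + Suc j) - y n) \<le> norm (y (Suc (n + j)) - y (n + j)) + norm (y (n + j) - y n)"
      using norm_triangle_ineq[of "y (Suc (n + j)) - y (n + j)" "y (n + j) - y n"] by simp
    also have "\<dots> \<le> (1/3)^(n + j) + 3/2 * (1/3)^n * (1 - (1/3)^j)"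
      by (intro add_mono step Suc.IH)
    also have "\<dots> = 3/2 * (1/3)^n * (1 - (1/3)^Suc j)"
      by (simp add: power_add field_simps)
    finally show ?case .
  qed simp
  have tail': "norm (y (n + j) - y n) \<le> 3/2 * (1/3)^n" for n j
    by (rule order_trans[OF tail mult_left_le]) auto
  have "Cauchy y"
  proof (rule metric_CauchyI)
    fix r :: real assume "r > 0"
    then obtain N where N: "(1/3)^N < r / 3"
      using real_arch_pow_inv[of "r / 3" "1/3"] by auto
    have "dist (y m) (y n) < r" if "m \<ge> N" "n \<ge> N" for m n
    proof -
      have "dist (y m) (y n) \<le> norm (y m - y N) + norm (y n - y N)"
        using norm_triangle_ineq4[of "y m - y N" "y n - y N"] by (simp add: dist_norm)
      moreover have "norm (y m - y N) \<le> 3/2 * (1/3)^N" "norm (y n - y N) \<le> 3/2 * (1/3)^N"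
        using tail'[of N "m - N"] tail'[of N "n - N"] that by simp_all
      ultimately show ?thesis using N by linarith
    qed
    then show "\<exists>M. \<forall>m\<ge>M. \<forall>n\<ge>M. dist (y m) (y n) < r" by blast
  qed
  then have "convergent y" by (rule Cauchy_convergent)
  then obtain l where l: "y \<longlonglongrightarrow> l" by (auto simp: convergent_def)
  have lV: "l \<in> V" using closed_sequentially[OF V(2)] yV l by blast
  have lim_le: "norm (l - y n) \<le> 3/2 * (1/3)^n" for n
  proof -
    have "(\<lambda>j. norm (y (n + j) - y n)) \<longlonglongrightarrow> norm (l - y n)"
      using LIMSEQ_ignore_initial_segment[OF l, of n]
      by (intro tendsto_intros) (simp add: add.commute)
    then show ?thesis using tail' by (intro LIMSEQ_le_const2) auto
  qed
  show thesis
  proof (rule that[OF lV])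
    fix k
    have "\<bar>(l - y (Suc k)) \<bullet> z k\<bar> \<le> norm (l - y (Suc k)) * norm (z k)"
      by (rule Cauchy_Schwarz_ineq2)
    also have "\<dots> \<le> (3/2 * (1/3)^Suc k) * norm (z k)"
      by (intro mult_right_mono lim_le) auto
    finally have "\<bar>(l - y (Suc k)) \<bullet> z k\<bar> \<le> 1/2 * (1/3)^k * norm (z k)" by simp
    moreover have "l \<bullet> z k = y (Suc k) \<bullet> z k + (l - y (Suc k)) \<bullet> z k"
      by (simp add: inner_diff_left)
    ultimately show "1/2 * (1/3)^k * norm (z k) \<le> \<bar>l \<bullet> z k\<bar>"
      using lower[of k] by (simp add: abs_if split: if_splits)
  qed
qed

section \<open>Algebraic sums as subspaces\<close>

lemma algebraic_sumE:
  assumes "x \<in> algebraic_sum S"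
  obtains k :: nat and v n where "x = (\<Sum>i<k. v i)" "\<And>i. i < k \<Longrightarrow> v i \<in> S (n i)"
proof -
  obtain k :: nat and v where kv: "x = (\<Sum>i<k. v i)" "\<forall>i<k. v i \<in> (\<Union>n. S n)"
    using assms by (auto simp: algebraic_sum_def)
  then have "\<forall>i. \<exists>n. i < k \<longrightarrow> v i \<in> S n" by blast
  then obtain n where "\<forall>i. i < k \<longrightarrow> v i \<in> S (n i)" by (rule choice[elim_format]) blast
  then show thesis using kv(1) that by blast
qed

lemma algebraic_sum_upper: "S n \<subseteq> algebraic_sum S"
proof
  fix x assume "x \<in> S n"
  then show "x \<in> algebraic_sum S"
    unfolding algebraic_sum_def by (intro CollectI exI[of _ "1::nat"] exI[of _ "\<lambda>_. x"]) auto
qed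

lemma algebraic_sum_add:
  assumes "x \<in> algebraic_sum S" "y \<in> algebraic_sum S"
  shows "x + y \<in> algebraic_sum S"
proof -
  obtain k :: nat and v where kv: "x = (\<Sum>i<k. v i)" "\<forall>i<k. v i \<in> (\<Union>n. S n)"
    using assms(1) by (auto simp: algebraic_sum_def)
  obtain l :: nat and w where lw: "y = (\<Sum>i<l. w i)" "\<forall>i<l. w i \<in> (\<Union>n. S n)"
    using assms(2) by (auto simp: algebraic_sum_def)
  define u where "u i = (if i < k then v i else w (i - k))" for i
  have "(\<Sum>i<k + m. u i) = (\<Sum>i<k. v i) + (\<Sum>i<m. w i)" for m
    by (induction m) (auto simp: u_def add.assoc)
  moreover have "\<forall>i<k + l. u i \<in> (\<Union>n. S n)"
    using kv(2) lw(2) by (simp add: u_def)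
  ultimately show ?thesis
    unfolding algebraic_sum_def kv(1) lw(1) by (intro CollectI exI[of _ "k + l"] exI[of _ u]) auto
qed

context hilbert_space
begin

lemma scale_bounded_ops: "c \<in> F \<Longrightarrow> (\<lambda>x. scale H c x) \<in> bounded_ops F H"
  by (rule bounded_opsI[where K = "cmod c"])
    (auto simp: scale_add_right scale_scale mult.commute norm_scale)

lemma is_subspace_closure:
  assumes "is_subspace F H V"
  shows "is_subspace F H (closure V)"
  unfolding is_subspace_def
proof (intro conjI ballI)
  show "0 \<in> closure V" using is_subspaceD(1)[OF assms] closure_subset by blast
next
  fix x y assume "x \<in> closure V" "y \<in> closure V"
  then obtain f g where f: "\<And>n. f n \<in> V" "f \<longlonglongrightarrow> x" and g: "\<And>n. g n \<in> V" "g \<longlonglongrightarrow> y"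
    unfolding closure_sequential by blast
  then show "x + y \<in> closure V"
    unfolding closure_sequential using is_subspaceD(2)[OF assms] tendsto_add[OF f(2) g(2)]
    by (intro exI[of _ "\<lambda>n. f n + g n"]) blast
next
  fix c x assume c: "c \<in> F" and "x \<in> closure V"
  then obtain f where f: "\<And>n. f n \<in> V" "f \<longlonglongrightarrow> x"
    unfolding closure_sequential by blast
  have "(\<lambda>n. scale H c (f n)) \<longlonglongrightarrow> scale H c x"
    by (rule bounded_ops_tendsto[OF scale_bounded_ops[OF c] f(2)])
  then show "scale H c x \<in> closure V"
    unfolding closure_sequential using is_subspaceD(4)[OF assms c] f(1)
    by (intro exI[of _ "\<lambda>n. scale H c (f n)"]) blast
qed

lemma is_subspace_algebraic_sum:
  assumes "\<And>n. is_subspace F H (S n)"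
  shows "is_subspace F H (algebraic_sum S)"
  unfolding is_subspace_def
proof (intro conjI ballI)
  show "0 \<in> algebraic_sum S"
    using algebraic_sum_upper[of S 0] is_subspaceD(1)[OF assms] by blast
next
  fix c x assume c: "c \<in> F" and "x \<in> algebraic_sum S"
  from this(2) obtain k :: nat and v n where kv: "x = (\<Sum>i<k. v i)" "\<And>i. i < k \<Longrightarrow> v i \<in> S (n i)"
    by (rule algebraic_sumE) blast
  have "scale H c x = (\<Sum>i<k. scale H c (v i))"
    unfolding kv(1) by (rule bounded_ops_linear(6)[OF scale_bounded_ops[OF c]])
  then show "scale H c x \<in> algebraic_sum S"
    unfolding algebraic_sum_def using is_subspaceD(4)[OF assms c] kv(2)
    by (intro CollectI exI[of _ k] exI[of _ "\<lambda>i. scale H c (v i)"]) blast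
qed (rule algebraic_sum_add)

lemma algebraic_sum_minimal:
  assumes "is_subspace F H V" "\<And>n. S n \<subseteq> V"
  shows "algebraic_sum S \<subseteq> V"
proof
  fix x assume "x \<in> algebraic_sum S"
  then obtain k :: nat and v n where kv: "x = (\<Sum>i<k. v i)" "\<And>i. i < k \<Longrightarrow> v i \<in> S (n i)"
    by (rule algebraic_sumE) blast
  then show "x \<in> V" using assms by (auto intro!: is_subspaceD(6)[OF assms(1)])
qed

text \<open>\<open>proj_Sup\<close> is a definite description, so a least upper bound has to be
  exhibited. The closure enters because the range of every upper bound is closed.\<close>

lemma proj_lub_exists:
  assumes "\<And>n. p n \<in> projections F H"
  obtains Q where "is_proj_lub F H (range p) Q" "range Q = closure (algebraic_sum (\<lambda>n. range (p n)))"
proof -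
  let ?M = "algebraic_sum (\<lambda>n. range (p n))"
  have "is_subspace F H ?M"
    by (rule is_subspace_algebraic_sum[OF projection_range(1)[OF assms]])
  then obtain Q where Q: "Q \<in> projections F H" "range Q = closure ?M"
    by (rule closed_subspace_projection[OF is_subspace_closure closed_closure])
  have "is_proj_lub F H (range p) Q"
    unfolding is_proj_lub_def
  proof (intro conjI Q(1) ballI impI)
    fix P assume "P \<in> range p"
    then obtain n where "P = p n" by blast
    then show "range P \<subseteq> range Q"
      unfolding Q(2) using algebraic_sum_upper[of "\<lambda>n. range (p n)" n] closure_subset[of ?M] by auto
  next
    fix R assume R: "R \<in> projections F H" "\<forall>P\<in>range p. range P \<subseteq> range R"
    then show "range Q \<subseteq> range R"
      unfolding Q(2) by (intro closure_minimal algebraic_sum_minimal projection_range[OF R(1)]) auto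
  qed
  then show thesis using Q(2) by (rule that)
qed

text \<open>If every such bound fails, there are \<open>x k\<close> with
  \<open>norm (P (x k)) = 5^k\<close> and \<open>norm (p i (x k)) \<le> 1\<close> for
  \<open>i < k\<close>. Inner products of the \<open>x k\<close> with a fixed vector of the
  algebraic sum are bounded from some index on, whereas the hump vector \<open>y\<close> in
  \<open>range P\<close> has \<open>\<bar>y \<bullet> x k\<bar> \<ge> (5/3)^k / 2\<close>.\<close>

lemma range_subset_dominated:
  assumes p: "\<And>n. p n \<in> projections F H" and P: "P \<in> projections F H"
    and sub: "range P \<subseteq> algebraic_sum (\<lambda>n. range (p n))"
  obtains C k where "C > 0" "\<And>x. (norm (P x))\<^sup>2 \<le> C * (\<Sum>i<k. (norm (p i x))\<^sup>2)"
proof (rule ccontr)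
  assume "\<not> thesis"
  \<comment> \<open>Constant and number of summands grow together, so one sequence serves for all
    pairs. The base \<open>25 = 5\<^sup>2\<close> matches the squared norms, and
    \<open>5 > 3\<close> outweighs the factor \<open>(1/3)^k\<close> of the gliding hump.\<close>
  then have "\<exists>x. \<not> (norm (P x))\<^sup>2 \<le> 25^k * (\<Sum>i<k. (norm (p i x))\<^sup>2)" for k
    using that[of "25^k" k] by auto
  then obtain x0 where x0: "\<And>k. 25^k * (\<Sum>i<k. (norm (p i (x0 k)))\<^sup>2) < (norm (P (x0 k)))\<^sup>2"
    by (metis not_le)
  define x where "x k = (5^k / norm (P (x0 k))) *\<^sub>R x0 k" for k
  have pos: "norm (P (x0 k)) > 0" for k
  proof -
    have "0 \<le> 25^k * (\<Sum>i<k. (norm (p i (x0 k)))\<^sup>2)" by (intro mult_nonneg_nonneg sum_nonneg) auto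
    then show ?thesis using x0[of k] by auto
  qed
  have Px: "norm (P (x k)) = 5^k" for k
    using pos[of k] by (simp add: x_def bounded_ops_linear[OF projectionsD(1)[OF P]])
  have px: "norm (p i (x k)) \<le> 1" if "i < k" for i k
  proof -
    have "(norm (p i (x k)))\<^sup>2 = 25^k / (norm (P (x0 k)))\<^sup>2 * (norm (p i (x0 k)))\<^sup>2"
      by (simp add: x_def bounded_ops_linear[OF projectionsD(1)[OF p]] power_mult_distrib
          power_divide power2_eq_square flip: power_mult_distrib)
    also have "\<dots> \<le> 25^k / (norm (P (x0 k)))\<^sup>2 * (\<Sum>i<k. (norm (p i (x0 k)))\<^sup>2)"
      using that by (intro mult_left_mono member_le_sum) auto
    also have "\<dots> \<le> 1"
      using x0[of k] pos[of k] by (simp add: field_simps)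
    finally show ?thesis by (simp add: power_le_one_iff abs_square_le_1)
  qed
  obtain y where y: "y \<in> range P" "\<And>k. 1/2 * (1/3)^k * norm (P (x k)) \<le> \<bar>y \<bullet> P (x k)\<bar>"
    using gliding_hump[OF is_subspace_real[OF projection_range(1)[OF P]] projection_range(2)[OF P],
        of "\<lambda>k. P (x k)"] by (metis rangeI)
  have "y \<in> algebraic_sum (\<lambda>n. range (p n))" using y(1) sub by blast
  then obtain m :: nat and v n where v: "y = (\<Sum>i<m. v i)" "\<And>i. i < m \<Longrightarrow> v i \<in> range (p (n i))"
    by (rule algebraic_sumE) blast
  define B where "B = (\<Sum>i<m. norm (v i))"
  \<comment> \<open>Exceeds every \<open>n i\<close>, so that for \<open>k \<ge> N\<close> all
    projections occurring in \<open>y\<close> are among those controlled on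
    \<open>x k\<close>.\<close>
  define N where "N = Suc (\<Sum>i<m. n i)"
  obtain K where K: "2 * B < (5/3)^K"
    using real_arch_pow[of "5/3" "2 * B"] by auto
  define k where "k = max K N"
  have nk: "n i < k" if "i < m" for i
    using member_le_sum[of i "{..<m}" n] that by (simp add: k_def N_def)
  have "\<bar>y \<bullet> P (x k)\<bar> = \<bar>y \<bullet> x k\<bar>"
    using projectionsD(3)[OF P, of y "x k"] y(1) projectionsD(5)[OF P] by simp
  also have "\<dots> \<le> (\<Sum>i<m. \<bar>v i \<bullet> x k\<bar>)"
    unfolding v(1) inner_sum_left by (rule sum_abs)
  also have "\<dots> \<le> B"
    unfolding B_def
  proof (rule sum_mono)
    fix i assume i: "i \<in> {..<m}"
    have "p (n i) (v i) = v i" using v(2)[of i] i projectionsD(5)[OF p] by simp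
    then have "\<bar>v i \<bullet> x k\<bar> = \<bar>v i \<bullet> p (n i) (x k)\<bar>"
      using projectionsD(3)[OF p, of "n i" "v i" "x k"] by simp
    also have "\<dots> \<le> norm (v i) * norm (p (n i) (x k))" by (rule Cauchy_Schwarz_ineq2)
    also have "\<dots> \<le> norm (v i)" using px[OF nk] i by (simp add: mult_left_le)
    finally show "\<bar>v i \<bullet> x k\<bar> \<le> norm (v i)" .
  qed
  finally have "1/2 * (1/3)^k * 5^k \<le> B" using y(2)[of k] Px[of k] by simp
  then have "(5/3)^k \<le> 2 * B" by (simp add: power_divide)
  moreover have "(5/3::real)^K \<le> (5/3)^k" by (rule power_increasing) (auto simp: k_def)
  ultimately show False using K by simp
qed

end

section \<open>Orthonormal sequences\<close>

context hilbert_space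
begin

text \<open>The Fourier partial sum; for orthonormal \<open>e\<close>, the projection onto the span
  of the first \<open>n\<close> vectors.\<close>

definition partial_expansion :: "(nat \<Rightarrow> 'a) \<Rightarrow> nat \<Rightarrow> 'a \<Rightarrow> 'a" where
  "partial_expansion e n x = (\<Sum>j<n. scale H (ip H x (e j)) (e j))"

definition orthonormal :: "(nat \<Rightarrow> 'a) \<Rightarrow> bool" where
  "orthonormal e \<longleftrightarrow> (\<forall>n. norm (e n) = 1) \<and> (\<forall>m n. m \<noteq> n \<longrightarrow> ip H (e m) (e n) = 0)"

lemma orthonormalI:
  assumes "\<And>n. norm (e n) = 1" "\<And>m n. m < n \<Longrightarrow> ip H (e n) (e m) = 0"
  shows "orthonormal e"
  unfolding orthonormal_def
proof (intro conjI allI impI assms(1))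
  fix m n :: nat assume "m \<noteq> n"
  then consider "m < n" | "n < m" by linarith
  then show "ip H (e m) (e n) = 0"
  proof cases
    case 1
    then show ?thesis using assms(2)[OF 1] ip_commute[of "e m" "e n"] by simp
  qed (rule assms(2))
qed

lemma orthonormal_inner: "orthonormal e \<Longrightarrow> m \<noteq> n \<Longrightarrow> e m \<bullet> e n = 0"
  by (simp flip: Re_ip add: orthonormal_def)

lemma partial_expansion_bounded: "partial_expansion e n \<in> bounded_ops F H"
  unfolding partial_expansion_def[abs_def] by (intro bounded_ops_sum rank_one_bounded)

lemma partial_expansion_compact: "partial_expansion e n \<in> compact_ops F H"
proof (induction n)
  case 0
  then show ?case
    by (auto simp: partial_expansion_def[abs_def] compact_ops_iff intro: exI[of _ "{0}"])
next
  case (Suc n)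
  then show ?case
    using compact_ops_add[OF Suc rank_one_compact[of "e n" "e n"]]
    by (simp add: partial_expansion_def[abs_def])
qed

lemma partial_expansion_basis:
  assumes "orthonormal e"
  shows "partial_expansion e n (e k) = (if k < n then e k else 0)"
proof -
  have "scale H (ip H (e k) (e j)) (e j) = (if j = k then e k else 0)" for j
    using assms by (cases "j = k") (auto simp: orthonormal_def ip_self)
  then show ?thesis by (simp add: partial_expansion_def)
qed

lemma partial_expansion_projection:
  assumes "orthonormal e"
  shows "partial_expansion e n \<in> projections F H"
proof -
  note B = partial_expansion_bounded[of e n]
  have "partial_expansion e n (partial_expansion e n x) = partial_expansion e n x" for x
  proof -
    have "partial_expansion e n (\<Sum>j<n. scale H (ip H x (e j)) (e j))
        = (\<Sum>j<n. scale H (ip H x (e j)) (e j))"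
      unfolding bounded_ops_linear(6)[OF B]
      by (rule sum.cong) (simp_all add: bounded_opsD(2)[OF B] ip_scalar partial_expansion_basis[OF assms])
    then show ?thesis by (simp add: partial_expansion_def)
  qed
  moreover have "partial_expansion e n x \<bullet> y = x \<bullet> partial_expansion e n y" for x y
    unfolding partial_expansion_def inner_sum_left inner_sum_right
    by (rule sum.cong) (simp_all add: rank_one_projection_inner)
  ultimately show ?thesis using B by (simp add: projections_iff)
qed

text \<open>The closed span of \<open>e\<close> is obtained as the set \<open>U\<close> of vectors
  to which their own expansions converge. \<open>U\<close> is closed because the partial expansions
  are contractions. Convergence for arbitrary \<open>x\<close> then follows from the projection onto
  \<open>U\<close> instead of from Bessel's inequality.\<close>

lemma orthonormal_limit_projection:
  assumes e: "orthonormal e"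
  obtains Q where "Q \<in> projections F H" "\<And>n. Q (e n) = e n"
    "\<And>x. (\<lambda>n. partial_expansion e n x) \<longlonglongrightarrow> Q x"
    "\<And>V. is_subspace F H V \<Longrightarrow> closed V \<Longrightarrow> range e \<subseteq> V \<Longrightarrow> range Q \<subseteq> V"
proof -
  let ?E = "partial_expansion e"
  note EB = partial_expansion_bounded[of e] and EP = partial_expansion_projection[OF e]
  define U where "U = {x. (\<lambda>n. ?E n x) \<longlonglongrightarrow> x}"
  have U: "is_subspace F H U"
    unfolding is_subspace_def U_def
    by (auto simp: bounded_ops_linear[OF EB] bounded_opsD(2)[OF EB]
        intro: tendsto_add bounded_ops_tendsto[OF scale_bounded_ops])
  have eU: "e k \<in> U" for k
  proof -
    have "eventually (\<lambda>n. ?E n (e k) = e k) sequentially"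
      using eventually_gt_at_top[of k]
      by eventually_elim (simp add: partial_expansion_basis[OF e])
    then show ?thesis unfolding U_def by (simp add: tendsto_eventually)
  qed
  have "closed U"
  proof (rule closed_sequential_limits[THEN iffD2], intro allI impI, elim conjE)
    fix f l assume f: "\<forall>n. f n \<in> U" "f \<longlonglongrightarrow> l"
    show "l \<in> U"
      unfolding U_def
    proof (rule CollectI, rule LIMSEQ_I)
      fix r :: real assume "r > 0"
      then obtain m where m: "norm (f m - l) < r / 3"
        using LIMSEQ_D[OF f(2), of "r / 3"] by auto
      have "(\<lambda>n. ?E n (f m)) \<longlonglongrightarrow> f m" using f(1) by (simp add: U_def)
      then obtain N where N: "\<And>n. n \<ge> N \<Longrightarrow> norm (?E n (f m) - f m) < r / 3"
        using LIMSEQ_D[of "\<lambda>n. ?E n (f m)" "f m" "r / 3"] \<open>r > 0\<close> by auto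
      have "norm (?E n l - l) < r" if "n \<ge> N" for n
      proof -
        have "?E n l - l = ?E n (l - f m) + (?E n (f m) - f m) + (f m - l)"
          by (simp add: bounded_ops_linear[OF EB])
        then have "norm (?E n l - l)
            \<le> norm (?E n (l - f m)) + norm (?E n (f m) - f m) + norm (f m - l)"
          by (metis norm_triangle_le norm_triangle_ineq add_right_mono)
        also have "norm (?E n (l - f m)) \<le> norm (f m - l)"
          using projection_norm_le[OF EP, of n "l - f m"] by (simp add: norm_minus_commute)
        finally show ?thesis using m N[OF that] by simp
      qed
      then show "\<exists>no. \<forall>n\<ge>no. norm (?E n l - l) < r" by blast
    qed
  qed
  from closed_subspace_projection[OF U this]
  obtain Q where Q: "Q \<in> projections F H" "range Q = U" .
  have Qe: "Q (e n) = e n" for n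
    using eU[of n] projectionsD(5)[OF Q(1)] Q(2) by blast
  have lim: "(\<lambda>n. ?E n x) \<longlonglongrightarrow> Q x" for x
  proof -
    \<comment> \<open>\<open>Q\<close> is symmetric and fixes \<open>e j\<close>, so the expansion
      of \<open>x\<close> is that of \<open>Q x\<close>, which lies in \<open>U\<close>.\<close>
    have "ip H x (e j) = ip H (Q x) (e j)" for j
      by (simp add: projectionsD(4)[OF Q(1)] Qe)
    then have "?E n x = ?E n (Q x)" for n by (simp add: partial_expansion_def)
    moreover have "Q x \<in> U" using Q(2) by blast
    ultimately show ?thesis by (simp add: U_def)
  qed
  have "range Q \<subseteq> V" if V: "is_subspace F H V" "closed V" "range e \<subseteq> V" for V
  proof
    fix y assume "y \<in> range Q"
    then obtain x where x: "y = Q x" by blast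
    have "?E n x \<in> V" for n
      unfolding partial_expansion_def using V(3)
      by (intro is_subspaceD(6)[OF V(1)] is_subspaceD(4)[OF V(1)] ip_scalar) auto
    then show "y \<in> V"
      unfolding x by (rule closed_sequentially[OF V(2) _ lim])
  qed
  with Q(1) Qe lim that show thesis by blast
qed

text \<open>The expansion beyond \<open>n\<close> contributes at most \<open>2 * (1/2)^n\<close>
  after applying \<open>A\<close>, so \<open>A \<circ> Q\<close> is a norm limit of finite rank
  operators. Smallness from an index \<open>i\<close> on suffices, as the earlier terms belong to
  the finite rank part.\<close>

lemma compact_ops_compose_orthonormal:
  assumes e: "orthonormal e" and A: "A \<in> bounded_ops F H"
    and small: "\<And>k. k \<ge> i \<Longrightarrow> norm (A (e k)) \<le> (1/2)^k"
    and Q: "Q \<in> projections F H" "\<And>x. (\<lambda>n. partial_expansion e n x) \<longlonglongrightarrow> Q x"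
  shows "(\<lambda>x. A (Q x)) \<in> compact_ops F H"
proof (rule compact_ops_limit)
  let ?E = "partial_expansion e"
  show "(\<lambda>x. A (Q x)) \<in> bounded_ops F H" using A projectionsD(1)[OF Q(1)] by simp
  fix c :: real assume c: "c > 0"
  obtain n0 where n0: "(1/2)^n0 < c / 2"
    using real_arch_pow_inv[of "c / 2" "1/2"] c by auto
  define n where "n = max n0 i"
  have "(1/2::real)^n \<le> (1/2)^n0" by (rule power_decreasing) (auto simp: n_def)
  then have n: "2 * (1/2)^n \<le> c" using n0 by linarith
  have diff: "norm (A (?E (n + j) x) - A (?E n x)) \<le> (2 * (1/2)^n * (1 - (1/2)^j)) * norm x" for j x
  proof (induction j)
    case (Suc j)
    have step: "A (?E (n + Suc j) x) - A (?E n x)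
        = (A (?E (n + j) x) - A (?E n x)) + scale H (ip H x (e (n + j))) (A (e (n + j)))"
      by (simp add: partial_expansion_def bounded_ops_linear(1)[OF A] bounded_opsD(2)[OF A] ip_scalar)
    have "cmod (ip H x (e (n + j))) * norm (A (e (n + j))) \<le> norm x * (1/2)^(n + j)"
      using norm_ip_le[of x "e (n + j)"] e
      by (intro mult_mono small) (auto simp: n_def orthonormal_def)
    then have "norm (A (?E (n + Suc j) x) - A (?E n x))
        \<le> (2 * (1/2)^n * (1 - (1/2)^j)) * norm x + norm x * (1/2)^(n + j)"
      unfolding step using Suc.IH
      by (intro norm_triangle_mono) (simp_all add: norm_scale ip_scalar)
    also have "\<dots> = (2 * (1/2)^n * (1 - (1/2)^Suc j)) * norm x"
      by (simp add: power_add field_simps)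
    finally show ?case .
  qed simp
  have "norm (A (Q x) - A (?E n x)) \<le> c * norm x" for x
  proof (rule LIMSEQ_le_const2)
    have "(\<lambda>j. ?E (j + n) x) \<longlonglongrightarrow> Q x"
      by (rule LIMSEQ_ignore_initial_segment[OF Q(2)])
    then show "(\<lambda>j. norm (A (?E (j + n) x) - A (?E n x))) \<longlonglongrightarrow> norm (A (Q x) - A (?E n x))"
      by (intro tendsto_intros bounded_ops_tendsto[OF A])
    have "norm (A (?E (j + n) x) - A (?E n x)) \<le> c * norm x" for j
    proof -
      have "2 * (1/2)^n * (1 - (1/2)^j) \<le> c"
        by (rule order_trans[OF mult_left_le n]) auto
      then have "(2 * (1/2)^n * (1 - (1/2)^j)) * norm x \<le> c * norm x"
        by (rule mult_right_mono) simp
      then show ?thesis using diff[of j x] by (simp add: add.commute)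
    qed
    then show "\<exists>N. \<forall>j\<ge>N. norm (A (?E (j + n) x) - A (?E n x)) \<le> c * norm x" by blast
  qed
  then show "\<exists>K\<in>compact_ops F H. \<forall>x. norm (A (Q x) - K x) \<le> c * norm x"
    using compact_ops_compose_left[OF A partial_expansion_compact[of e n]]
    by (intro bexI[of _ "\<lambda>x. A (?E n x)"]) auto
qed

section \<open>Noncompact operators and orthonormal sequences\<close>

lemma norm_orthogonal_sum:
  fixes n :: nat
  assumes "\<And>m n. m < n \<Longrightarrow> ip H (g n) (g m) = 0" "\<And>j. c j \<in> F"
  shows "(norm (\<Sum>j<n. scale H (c j) (g j)))\<^sup>2 = (\<Sum>j<n. (cmod (c j))\<^sup>2 * (norm (g j))\<^sup>2)"
proof (induction n)
  case (Suc n)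
  have "scale H (c n) (g n) \<bullet> scale H (c j) (g j) = 0" if "j < n" for j
    using assms that by (simp flip: Re_ip add: ip_scale_left ip_scale_right)
  then have "scale H (c n) (g n) \<bullet> (\<Sum>j<n. scale H (c j) (g j)) = 0"
    by (simp add: inner_sum_right)
  then show ?case
    using Suc by (simp add: power2_norm_eq_inner inner_add_left inner_add_right inner_commute)
      (simp add: dot_square_norm norm_scale assms(2) power_mult_distrib)
qed simp

text \<open>Pythagoras holds on both sides, for the \<open>e j\<close> and, by \<open>orth\<close>,
  for their images. The bound on the \<open>e j\<close> thus extends to finite combinations and, by
  \<open>lim\<close>, to limits of these.\<close>

lemma orthogonal_images_bounded_below:
  assumes e: "orthonormal e" and T: "T \<in> bounded_ops F H"
    and orth: "\<And>m n. m < n \<Longrightarrow> ip H (T (e n)) (T (e m)) = 0"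
    and c: "c \<ge> 0" "\<And>n. c \<le> norm (T (e n))"
    and lim: "(\<lambda>n. partial_expansion e n x) \<longlonglongrightarrow> x"
  shows "c * norm x \<le> norm (T x)"
proof (rule LIMSEQ_le)
  let ?E = "partial_expansion e"
  show "(\<lambda>n. c * norm (?E n x)) \<longlonglongrightarrow> c * norm x"
    by (intro tendsto_intros lim)
  show "(\<lambda>n. norm (T (?E n x))) \<longlonglongrightarrow> norm (T x)"
    by (intro tendsto_intros bounded_ops_tendsto[OF T] lim)
  have "c * norm (?E n x) \<le> norm (T (?E n x))" for n
  proof (rule power2_le_imp_le)
    have "(c * norm (?E n x))\<^sup>2 = c\<^sup>2 * (\<Sum>j<n. (cmod (ip H x (e j)))\<^sup>2)"
      using norm_orthogonal_sum[of e "\<lambda>j. ip H x (e j)" n] e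
      by (simp add: partial_expansion_def power_mult_distrib orthonormal_def ip_scalar)
    also have "\<dots> = (\<Sum>j<n. (cmod (ip H x (e j)))\<^sup>2 * c\<^sup>2)"
      by (simp add: sum_distrib_left mult.commute)
    also have "\<dots> \<le> (\<Sum>j<n. (cmod (ip H x (e j)))\<^sup>2 * (norm (T (e j)))\<^sup>2)"
      by (intro sum_mono mult_left_mono power_mono c) auto
    also have "\<dots> = (norm (\<Sum>j<n. scale H (ip H x (e j)) (T (e j))))\<^sup>2"
      using norm_orthogonal_sum[of "\<lambda>j. T (e j)" "\<lambda>j. ip H x (e j)" n] orth
      by (simp add: ip_scalar)
    also have "(\<Sum>j<n. scale H (ip H x (e j)) (T (e j))) = T (?E n x)"
      by (simp add: partial_expansion_def bounded_ops_linear(6)[OF T] bounded_opsD(2)[OF T] ip_scalar)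
    finally show "(c * norm (?E n x))\<^sup>2 \<le> (norm (T (?E n x)))\<^sup>2" .
  qed simp
  then show "\<exists>N. \<forall>n\<ge>N. c * norm (?E n x) \<le> norm (T (?E n x))" by blast
qed

lemma projection_id: "(\<lambda>x. x) \<in> projections F H"
  by (simp add: projections_iff)

text \<open>Choosing \<open>e\<^sub>n\<close> orthogonal to \<open>T\<^sup>*T e\<^sub>i\<close> for \<open>i < n\<close> makes the images orthogonal.\<close>

lemma noncompact_orthonormal:
  assumes T: "T \<in> bounded_ops F H" "T \<notin> compact_ops F H"
    and adj: "\<And>x y. ip H (T x) y = ip H x (T' y)"
  obtains e c where "orthonormal e" "\<And>m n. m < n \<Longrightarrow> ip H (T (e n)) (T (e m)) = 0"
    "c > 0" "\<And>n. c \<le> norm (T (e n))"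
proof -
  \<comment> \<open>If for every \<open>c\<close> finitely many orthogonality conditions brought
    \<open>T\<close> below \<open>c\<close>, the finite rank operators \<open>T \<circ> E\<close>
    would approximate \<open>T\<close> in norm.\<close>
  have "\<exists>c>0. \<forall>S. finite S \<longrightarrow> (\<exists>x. (\<forall>s\<in>S. ip H x s = 0) \<and> c * norm x < norm (T x))"
  proof (rule ccontr)
    assume neg: "\<not> ?thesis"
    have "T \<in> compact_ops F H"
    proof (rule compact_ops_limit[OF T(1)])
      fix c :: real assume "c > 0"
      then obtain S where S: "finite S" "\<And>x. (\<forall>s\<in>S. ip H x s = 0) \<Longrightarrow> norm (T x) \<le> c * norm x"
        using neg by (meson not_le)
      obtain E where E: "E \<in> projections F H" "E \<in> compact_ops F H" "\<And>s. s \<in> S \<Longrightarrow> E s = s"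
        by (rule finite_rank_projection[OF S(1)]) blast
      have E': "(\<lambda>x. x - E x) \<in> projections F H"
        by (rule projection_diff(1)[OF E(1) projection_id]) auto
      have "norm (T x - T (E x)) \<le> c * norm x" for x
      proof -
        have "ip H (x - E x) s = 0" if "s \<in> S" for s
          using projectionsD(4)[OF E', of x s] E(3)[OF that] by simp
        then have "norm (T (x - E x)) \<le> c * norm (x - E x)" by (intro S(2)) blast
        also have "\<dots> \<le> c * norm x"
          using projection_norm_le[OF E', of x] \<open>c > 0\<close> by simp
        finally show ?thesis by (simp add: bounded_ops_linear[OF T(1)])
      qed
      then show "\<exists>K\<in>compact_ops F H. \<forall>x. norm (T x - K x) \<le> c * norm x"
        using compact_ops_compose_left[OF T(1) E(2)] by (intro bexI[of _ "\<lambda>x. T (E x)"]) auto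
    qed
    with T(2) show False ..
  qed
  then obtain c where c: "c > 0"
    "\<And>S. finite S \<Longrightarrow> \<exists>x. (\<forall>s\<in>S. ip H x s = 0) \<and> c * norm x < norm (T x)"
    by blast
  define R where "R f n x \<longleftrightarrow> norm x = 1 \<and> c \<le> norm (T x) \<and>
      (\<forall>i<n. ip H x (f i) = 0 \<and> ip H x (T' (T (f i))) = 0)" for f and n :: nat and x
  have "\<exists>f. \<forall>n. R f n (f n)"
  proof (rule dependent_wellorder_choice)
    fix n :: nat and f :: "nat \<Rightarrow> 'a"
    have "finite (f ` {..<n} \<union> (\<lambda>i. T' (T (f i))) ` {..<n})" by simp
    from c(2)[OF this]
    obtain x where x: "\<And>s. s \<in> f ` {..<n} \<union> (\<lambda>i. T' (T (f i))) ` {..<n} \<Longrightarrow> ip H x s = 0"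
      "c * norm x < norm (T x)"
      by blast
    \<comment> \<open>The strict inequality in the choice of \<open>x\<close> rules out
      \<open>0\<close> and permits normalising.\<close>
    have x0: "x \<noteq> 0" using x(2) bounded_ops_linear(4)[OF T(1)] by auto
    then have "R f n ((1 / norm x) *\<^sub>R x)"
      using x by (auto simp: R_def bounded_ops_linear(3)[OF T(1)] ip_scaleR_left field_simps)
    then show "\<exists>x. R f n x" ..
  qed (auto simp: R_def)
  then obtain f where f: "\<And>n. R f n (f n)" by blast
  show thesis
  proof (rule that[of f c])
    show "orthonormal f" using f by (intro orthonormalI) (auto simp: R_def)
    show "ip H (T (f n)) (T (f m)) = 0" if "m < n" for m n
      using f[of n] that by (auto simp: R_def adj)
    show "c \<le> norm (T (f n))" for n using f[of n] by (simp add: R_def)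
  qed (rule c(1))
qed

lemma is_subspace_image:
  assumes V: "is_subspace F H V" and A: "A \<in> bounded_ops F H"
  shows "is_subspace F H (A ` V)"
  unfolding is_subspace_def
proof (intro conjI ballI)
  show "0 \<in> A ` V"
    using image_eqI[of 0 A 0 V] by (simp add: bounded_ops_linear[OF A] is_subspaceD[OF V])
  fix x assume x: "x \<in> A ` V"
  then obtain a where a: "a \<in> V" "x = A a" by blast
  show "x + y \<in> A ` V" if y: "y \<in> A ` V" for y
  proof -
    obtain b where b: "b \<in> V" "y = A b" using y by blast
    show ?thesis
      using imageI[OF is_subspaceD(2)[OF V a(1) b(1)], of A] by (simp add: a b bounded_ops_linear[OF A])
  qed
  show "scale H c x \<in> A ` V" if "c \<in> F" for c
    using imageI[OF is_subspaceD(4)[OF V that a(1)], of A] that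
    by (simp add: a bounded_opsD(2)[OF A])
qed

lemma is_subspace_vimage:
  assumes W: "is_subspace F H W" and A: "A \<in> bounded_ops F H"
  shows "is_subspace F H {x. A x \<in> W}"
  unfolding is_subspace_def
  by (simp add: bounded_ops_linear[OF A] bounded_opsD(2)[OF A] is_subspaceD[OF W])

lemma noncompact_extension:
  assumes P: "P \<in> projections F H" and R: "R \<in> projections F H"
    and nc: "(\<lambda>x. R x - P (R x)) \<notin> compact_ops F H"
  obtains V where "is_subspace F H V" "closed V" "range P \<subseteq> V"
    "\<And>v. v \<in> V \<Longrightarrow> \<exists>a\<in>range P. \<exists>b\<in>range R. v = a + b"
    "infinite_dim_quotient F H V (range P)"
proof -
  define T where "T = (\<lambda>x. R x - P (R x))"
  note PB = projectionsD(1)[OF P] and RB = projectionsD(1)[OF R]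
  have TB: "T \<in> bounded_ops F H" unfolding T_def using PB RB by simp
  have P': "(\<lambda>x. x - P x) \<in> projections F H"
    by (rule projection_diff(1)[OF P projection_id]) auto
  have adj: "ip H (T x) y = ip H x (R (y - P y))" for x y
    using projectionsD(4)[OF P', of "R x" y] projectionsD(4)[OF R, of x "y - P y"]
    by (simp add: T_def)
  have PT: "P (T x) = 0" for x
    by (simp add: T_def bounded_ops_linear[OF PB] projectionsD(2)[OF P])
  have "T \<notin> compact_ops F H" using nc by (simp add: T_def)
  then obtain e c where e: "orthonormal e" "\<And>m n. m < n \<Longrightarrow> ip H (T (e n)) (T (e m)) = 0"
    and c: "c > 0" "\<And>n. c \<le> norm (T (e n))"
    by (rule noncompact_orthonormal[OF TB _ adj]) blast
  obtain Q where Q: "Q \<in> projections F H" "\<And>n. Q (e n) = e n"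
    "\<And>x. (\<lambda>n. partial_expansion e n x) \<longlonglongrightarrow> Q x"
    by (rule orthonormal_limit_projection[OF e(1)]) blast
  define W where "W = T ` range Q"
  have "complete W"
    unfolding W_def
  proof (rule complete_isometric_image[OF c(1)])
    show "subspace (range Q)" by (rule is_subspace_real[OF projection_range(1)[OF Q(1)]])
    show "bounded_linear T" by (rule bounded_opsD(1)[OF TB])
    show "\<forall>x\<in>range Q. c * norm x \<le> norm (T x)"
    proof
      fix x assume "x \<in> range Q"
      then have "Q x = x" using projectionsD(5)[OF Q(1)] by blast
      then have "(\<lambda>n. partial_expansion e n x) \<longlonglongrightarrow> x" using Q(3)[of x] by simp
      then show "c * norm x \<le> norm (T x)"
        using c by (intro orthogonal_images_bounded_below[OF e(1) TB e(2)]) auto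
    qed
    show "complete (range Q)" using projection_range(2)[OF Q(1)] by (simp add: complete_eq_closed)
  qed
  then have W_closed: "closed W" by (simp add: complete_eq_closed)
  have W: "is_subspace F H W"
    unfolding W_def by (rule is_subspace_image[OF projection_range(1)[OF Q(1)] TB])
  \<comment> \<open>This is \<open>range P + W\<close>, an orthogonal sum as \<open>P\<close>
    vanishes on \<open>W\<close>. Written as a preimage under \<open>1 - P\<close>, it is closed by
    continuity.\<close>
  define V where "V = {v. v - P v \<in> W}"
  note P'B = projectionsD(1)[OF P']
  have V: "is_subspace F H V"
    unfolding V_def by (rule is_subspace_vimage[OF W P'B])
  have V_closed: "closed V"
  proof -
    have "closed ((\<lambda>x. x - P x) -` W)"
      by (intro continuous_closed_vimage W_closed
          continuous_on_eq_continuous_at[OF open_UNIV, THEN iffD1, rule_format]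
          bounded_ops_continuous P'B UNIV_I)
    then show ?thesis by (simp add: V_def vimage_def)
  qed
  have PV: "range P \<subseteq> V"
    using is_subspaceD(1)[OF W] by (auto simp: V_def projectionsD(2)[OF P])
  have V_sum: "\<exists>a\<in>range P. \<exists>b\<in>range R. v = a + b" if v: "v \<in> V" for v
  proof -
    obtain u where "v - P v = R u - P (R u)"
      using v by (auto simp: V_def W_def T_def)
    \<comment> \<open>The term \<open>P (R u)\<close> is absorbed into \<open>range P\<close>, so
      \<open>V\<close> stays within the sum of the two ranges.\<close>
    then have "v = P (v - R u) + R u"
      by (simp add: bounded_ops_linear[OF PB] algebra_simps)
    then show ?thesis by blast
  qed
  obtain D where D: "D \<in> projections F H" "range D = V"
    by (rule closed_subspace_projection[OF V V_closed])
  have "(\<lambda>x. D x - P x) \<notin> compact_ops F H"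
  proof
    assume comp: "(\<lambda>x. D x - P x) \<in> compact_ops F H"
    \<comment> \<open>The normalised images are orthonormal, lie in \<open>V\<close> and are killed
      by \<open>P\<close>, so \<open>D - P\<close> fixes them all.\<close>
    define f where "f n = (1 / norm (T (e n))) *\<^sub>R T (e n)" for n
    have pos: "norm (T (e n)) > 0" for n using c(1) c(2)[of n] by linarith
    have Pf: "P (f n) = 0" for n by (simp add: f_def bounded_ops_linear[OF PB] PT)
    have fW: "f n \<in> W" for n
      unfolding f_def using Q(2)[of n] by (intro is_subspaceD(5)[OF W]) (metis W_def imageI rangeI)
    have "f n \<in> V" for n using fW by (simp add: V_def Pf)
    then have Df: "D (f n) = f n" for n using D projectionsD(5)[OF D(1)] by blast
    show False
    proof (rule compact_ops_not_fix_orthonormal[OF comp, of f])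
      show "D (f n) - P (f n) = f n" for n by (simp add: Df Pf)
      show "norm (f n) = 1" for n using pos[of n] by (simp add: f_def)
      show "f m \<bullet> f n = 0" if "m < n" for m n
        using e(2)[OF that] Re_ip[of "T (e n)" "T (e m)"] by (simp add: f_def inner_commute)
    qed
  qed
  then have "infinite_dim_quotient F H V (range P)"
    using infinite_dim_quotient_iff[OF P D(1)] PV D(2) by simp
  with V V_closed PV V_sum show thesis by (rule that)
qed

end

section \<open>Sums that are not closed\<close>

context hilbert_space
begin

text \<open>
  Otherwise \<open>T = \<Sum>i<k. p i\<close> would be coercive on the orthogonal complement \<open>N\<close> of \<open>S\<close> in the closure of
  the sum, so its compression to \<open>N\<close> would be onto \<open>N\<close>.  Since the vectors in \<open>S\<close> lie in the sum,
  the sum would contain its closure.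
\<close>

lemma nonclosed_sum_small_vector:
  assumes p: "\<And>n. p n \<in> projections F H" and nc: "\<not> closed (algebraic_sum (\<lambda>n. range (p n)))"
    and S: "finite S" "S \<subseteq> algebraic_sum (\<lambda>n. range (p n))" and \<epsilon>: "\<epsilon> > 0"
  obtains x where "x \<in> algebraic_sum (\<lambda>n. range (p n))" "norm x = 1"
    "\<And>s. s \<in> S \<Longrightarrow> ip H x s = 0" "\<And>i. i < k \<Longrightarrow> norm (p i x) \<le> \<epsilon>"
proof (rule ccontr)
  assume no: "\<not> thesis"
  note found = that
  define M where "M = algebraic_sum (\<lambda>n. range (p n))"
  have M: "is_subspace F H M"
    unfolding M_def by (rule is_subspace_algebraic_sum[OF projection_range(1)[OF p]])
  note pB = projectionsD(1)[OF p]
  have below: "\<epsilon>\<^sup>2 * (x \<bullet> x) \<le> (\<Sum>i<k. (norm (p i x))\<^sup>2)"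
    if x: "x \<in> M" "\<And>s. s \<in> S \<Longrightarrow> ip H x s = 0" for x
  proof (cases "x = 0")
    case False
    define u where "u = (1 / norm x) *\<^sub>R x"
    have "u \<in> M" "norm u = 1" "\<And>s. s \<in> S \<Longrightarrow> ip H u s = 0"
      using x False by (auto simp: u_def ip_scaleR_left is_subspaceD(5)[OF M])
    then have "\<not> (\<forall>i<k. norm (p i u) \<le> \<epsilon>)"
      using no found[of u] unfolding M_def by blast
    then obtain i where i: "i < k" "\<epsilon> < norm (p i u)" by auto
    then have "\<epsilon> * norm x \<le> norm (p i x)"
      using False by (simp add: u_def bounded_ops_linear(3)[OF pB] field_simps)
    then have "(\<epsilon> * norm x)\<^sup>2 \<le> (norm (p i x))\<^sup>2"
      using \<epsilon> by (intro power_mono) auto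
    also have "\<dots> \<le> (\<Sum>i<k. (norm (p i x))\<^sup>2)"
      using i(1) by (intro member_le_sum) auto
    finally show ?thesis by (simp add: power_mult_distrib power2_norm_eq_inner)
  qed (simp add: sum_nonneg)
  obtain Q where Q: "Q \<in> projections F H" "range Q = closure M"
    by (rule closed_subspace_projection[OF is_subspace_closure[OF M] closed_closure])
  obtain E where E: "E \<in> projections F H" "\<And>s. s \<in> S \<Longrightarrow> E s = s" "range E \<subseteq> M"
    by (rule finite_rank_projection[OF S(1)]) (use M S(2) in \<open>auto simp: M_def\<close>)
  note EB = projectionsD(1)[OF E(1)] and QB = projectionsD(1)[OF Q(1)]
  have EQ: "range E \<subseteq> range Q" using E(3) Q(2) closure_subset by blast
  define D where "D = (\<lambda>x. Q x - E x)"
  have D: "D \<in> projections F H" unfolding D_def by (rule projection_diff(1)[OF E(1) Q(1) EQ])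
  note DB = projectionsD(1)[OF D]
  have E': "(\<lambda>x. x - E x) \<in> projections F H"
    by (rule projection_diff(1)[OF E(1) projection_id]) auto
  \<comment> \<open>The bound passes to the closure by limits. Subtracting \<open>E (f n)\<close>
    makes the approximating vectors orthogonal to \<open>S\<close> and keeps them in
    \<open>M\<close>, as \<open>range E \<subseteq> M\<close>.\<close>
  have below': "\<epsilon>\<^sup>2 * (D x \<bullet> D x) \<le> (\<Sum>i<k. (norm (p i (D x)))\<^sup>2)" for x
  proof -
    have ED: "E (D x) = 0"
      by (simp add: D_def bounded_ops_linear[OF EB] projectionsD(2)[OF E(1)]
          projection_diff(3)[OF E(1) Q(1) EQ])
    have "D x = Q (D x)"
      by (simp add: D_def bounded_ops_linear[OF QB] projectionsD(2)[OF Q(1)]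
          projection_diff(2)[OF E(1) Q(1) EQ])
    then have "D x \<in> closure M" using Q(2) by (metis rangeI)
    then obtain f where f: "\<And>n. f n \<in> M" "f \<longlonglongrightarrow> D x"
      unfolding closure_sequential by blast
    define g where "g n = f n - E (f n)" for n
    have "g n \<in> M" for n
      using f(1) E(3) unfolding g_def by (intro is_subspaceD(3)[OF M]) auto
    moreover have "ip H (g n) s = 0" if "s \<in> S" for n s
      using projectionsD(4)[OF E', of "f n" s] E(2)[OF that] by (simp add: g_def)
    ultimately have g: "\<epsilon>\<^sup>2 * (g n \<bullet> g n) \<le> (\<Sum>i<k. (norm (p i (g n)))\<^sup>2)" for n
      by (rule below)
    have "g \<longlonglongrightarrow> D x - E (D x)"
      unfolding g_def by (intro tendsto_diff f(2) bounded_ops_tendsto[OF EB])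
    then have glim: "g \<longlonglongrightarrow> D x" by (simp add: ED)
    show ?thesis
    proof (rule LIMSEQ_le)
      show "(\<lambda>n. \<epsilon>\<^sup>2 * (g n \<bullet> g n)) \<longlonglongrightarrow> \<epsilon>\<^sup>2 * (D x \<bullet> D x)"
        by (intro tendsto_intros glim)
      show "(\<lambda>n. \<Sum>i<k. (norm (p i (g n)))\<^sup>2) \<longlonglongrightarrow> (\<Sum>i<k. (norm (p i (D x)))\<^sup>2)"
        by (intro tendsto_intros bounded_ops_tendsto[OF pB] glim)
    qed (use g in blast)
  qed
  define T where "T = (\<lambda>x. \<Sum>i<k. p i x)"
  have TB: "T \<in> bounded_ops F H" unfolding T_def using pB by (rule bounded_ops_sum)
  have TM: "T x \<in> M" for x
    unfolding T_def M_def using algebraic_sum_upper[of "\<lambda>n. range (p n)"]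
    by (intro is_subspaceD(6)[OF M[unfolded M_def]]) blast
  have Tx: "T x \<bullet> x = (\<Sum>i<k. (norm (p i x))\<^sup>2)" for x
    by (simp add: T_def inner_sum_left projection_norm_sq[OF p])
  \<comment> \<open>The compression of \<open>T\<close> to the range of \<open>D\<close>, completed
    by the identity on the orthogonal complement so as to be coercive on the whole space.\<close>
  define L where "L = (\<lambda>x. D (T (D x)) + (x - D x))"
  have LB: "L \<in> bounded_ops F H"
    unfolding L_def
    by (rule bounded_ops_intros(1)[OF bounded_ops_intros(3)[OF DB bounded_ops_intros(3)[OF TB DB]]
          bounded_ops_intros(2)[OF bounded_ops_intros(5) DB]])
  have coercive: "min (\<epsilon>\<^sup>2) 1 * (x \<bullet> x) \<le> L x \<bullet> x" for x
  proof -
    have orth: "(x - D x) \<bullet> D x = 0"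
      using projectionsD(3)[OF D, of "x - D x" x]
      by (simp add: bounded_ops_linear[OF DB] projectionsD(2)[OF D] inner_commute)
    have xx: "x \<bullet> x = D x \<bullet> D x + (x - D x) \<bullet> (x - D x)"
      using orth by (simp add: inner_diff_left inner_diff_right inner_commute)
    have Lx: "L x \<bullet> x = T (D x) \<bullet> D x + (x - D x) \<bullet> (x - D x)"
      using orth projectionsD(3)[OF D, of "T (D x)" x]
      by (simp add: L_def inner_add_left inner_add_right inner_diff_left inner_diff_right inner_commute)
    have "min (\<epsilon>\<^sup>2) 1 * (D x \<bullet> D x) \<le> \<epsilon>\<^sup>2 * (D x \<bullet> D x)"
      by (intro mult_right_mono) auto
    also have "\<dots> \<le> T (D x) \<bullet> D x" unfolding Tx by (rule below')
    finally have 1: "min (\<epsilon>\<^sup>2) 1 * (D x \<bullet> D x) \<le> T (D x) \<bullet> D x" .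
    have 2: "min (\<epsilon>\<^sup>2) 1 * ((x - D x) \<bullet> (x - D x)) \<le> 1 * ((x - D x) \<bullet> (x - D x))"
      by (intro mult_right_mono) auto
    from 1 2 show ?thesis unfolding xx Lx distrib_left by linarith
  qed
  obtain G where G: "\<And>x. L (G x) = x"
    by (rule coercive_inverse[OF LB _ coercive]) (use \<epsilon> in auto)
  have "Q y \<in> M" for y
  proof -
    \<comment> \<open>\<open>w\<close> solves \<open>D (T w) = D y\<close>. Since
      \<open>D = Q - E\<close>, the vectors \<open>Q y\<close> and \<open>T w\<close> differ by an
      element of \<open>range E\<close>, and both \<open>T w\<close> and \<open>range E\<close> lie
      in \<open>M\<close>.\<close>
    define w where "w = D (G (D y))"
    have "D (L (G (D y))) = D (T w)"
      by (simp add: L_def w_def bounded_ops_linear[OF DB] projectionsD(2)[OF D])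
    then have "D y = D (T w)" by (simp add: G projectionsD(2)[OF D])
    moreover have "Q (T w) = T w"
      using TM[of w] Q(2) closure_subset projectionsD(5)[OF Q(1)] by blast
    ultimately have "D y = T w - E (T w)" by (simp add: D_def)
    moreover have "Q y = D y + E y" by (simp add: D_def)
    ultimately have "Q y = (T w - E (T w)) + E y" by simp
    moreover have "E z \<in> M" for z using E(3) by blast
    ultimately show ?thesis using TM by (auto intro!: is_subspaceD(2,3)[OF M])
  qed
  then have "range Q \<subseteq> M" by blast
  then have "closure M \<subseteq> M" by (simp only: Q(2))
  then have "closed M" using closure_subset[of M] closed_closure[of M] by (simp add: subset_antisym)
  with nc show False by (simp add: M_def)
qed

lemma nonclosed_sum_noncompact_projection:
  assumes p: "\<And>n. p n \<in> projections F H" and nc: "\<not> closed (algebraic_sum (\<lambda>n. range (p n)))"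
  obtains K where "K \<in> projections F H" "K \<notin> compact_ops F H"
    "range K \<subseteq> closure (algebraic_sum (\<lambda>n. range (p n)))"
    "\<And>i. (\<lambda>x. p i (K x)) \<in> compact_ops F H"
proof -
  define M where "M = algebraic_sum (\<lambda>n. range (p n))"
  have M: "is_subspace F H M"
    unfolding M_def by (rule is_subspace_algebraic_sum[OF projection_range(1)[OF p]])
  \<comment> \<open>Only finitely many projections are made small at a time, hence
    \<open>i < n\<close>. The powers of \<open>1/2\<close> are summable, which is what compactness
    of \<open>p i \<circ> K\<close> will rest on.\<close>
  define R where "R f n x \<longleftrightarrow> x \<in> M \<and> norm x = 1 \<and> (\<forall>i<n. ip H x (f i) = 0) \<and>
      (\<forall>i<n. norm (p i x) \<le> (1/2)^n)" for f and n :: nat and x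
  have "\<exists>f. \<forall>n. R f n (f n)"
  proof (rule dependent_wellorder_choice)
    fix n f assume f: "\<And>i. i < n \<Longrightarrow> R f i (f i)"
    have fS: "finite (f ` {..<n})" "f ` {..<n} \<subseteq> algebraic_sum (\<lambda>n. range (p n))"
      using f by (auto simp: R_def M_def)
    obtain x where "x \<in> algebraic_sum (\<lambda>n. range (p n))" "norm x = 1"
      "\<And>s. s \<in> f ` {..<n} \<Longrightarrow> ip H x s = 0" "\<And>i. i < n \<Longrightarrow> norm (p i x) \<le> (1/2)^n"
      by (rule nonclosed_sum_small_vector[OF p nc fS, of "(1/2)^n" n]) auto
    then have "R f n x" by (auto simp: R_def M_def)
    then show "\<exists>x. R f n x" ..
  qed (auto simp: R_def)
  then obtain e where "\<And>n. R e n (e n)" by blast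
  then have e: "\<And>n. e n \<in> M" "\<And>n. norm (e n) = 1" "\<And>m n. m < n \<Longrightarrow> ip H (e n) (e m) = 0"
    "\<And>i n. i < n \<Longrightarrow> norm (p i (e n)) \<le> (1/2)^n"
    by (auto simp: R_def)
  have on: "orthonormal e" by (rule orthonormalI[OF e(2,3)])
  obtain K where K: "K \<in> projections F H" "\<And>n. K (e n) = e n"
    "\<And>x. (\<lambda>n. partial_expansion e n x) \<longlonglongrightarrow> K x"
    "\<And>V. is_subspace F H V \<Longrightarrow> closed V \<Longrightarrow> range e \<subseteq> V \<Longrightarrow> range K \<subseteq> V"
    by (rule orthonormal_limit_projection[OF on]) blast
  show thesis
  proof (rule that[OF K(1)])
    show "K \<notin> compact_ops F H"
      using compact_ops_not_fix_orthonormal[of K e] K(2) e(2) orthonormal_inner[OF on] by fastforce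
    show "range K \<subseteq> closure (algebraic_sum (\<lambda>n. range (p n)))"
      unfolding M_def[symmetric] using e(1) closure_subset[of M]
      by (intro K(4) is_subspace_closure M) auto
    show "(\<lambda>x. p i (K x)) \<in> compact_ops F H" for i
      \<comment> \<open>The estimate for \<open>p i\<close> holds for \<open>n > i\<close>, hence
        the starting index \<open>Suc i\<close>.\<close>
      by (rule compact_ops_compose_orthonormal[OF on projectionsD(1)[OF p] _ K(1,3), of "Suc i"])
        (use e(4) in auto)
  qed
qed

end

section \<open>Homomorphisms of operator algebras\<close>

text \<open>This is \<open>A\<^sup>2 \<le> N A\<close>: a small form forces a small image.
  Positivity is evaluated at \<open>x - A x / N\<close>, where the quadratic term, estimated by
  \<open>N\<close>, cancels half of the linear one.\<close>

lemma positive_Cauchy_Schwarz: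
  fixes A :: "'a::real_inner \<Rightarrow> 'a"
  assumes A: "linear A" "\<And>x y. A x \<bullet> y = x \<bullet> A y" "\<And>x. 0 \<le> A x \<bullet> x"
    and N: "N > 0" "\<And>x. norm (A x) \<le> N * norm x"
  shows "(norm (A x))\<^sup>2 \<le> N * (A x \<bullet> x)"
proof -
  let ?t = "1 / N"
  have "A (A x) \<bullet> A x \<le> norm (A (A x)) * norm (A x)" by (rule norm_cauchy_schwarz)
  also have "\<dots> \<le> (N * norm (A x)) * norm (A x)" by (intro mult_right_mono N) auto
  finally have le: "A (A x) \<bullet> A x \<le> N * (norm (A x))\<^sup>2" by (simp add: power2_eq_square mult.assoc)
  have AAx: "A (A x) \<bullet> x = A x \<bullet> A x" by (rule A(2))
  have "0 \<le> A (x - ?t *\<^sub>R A x) \<bullet> (x - ?t *\<^sub>R A x)" by (rule A(3))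
  also have "\<dots> = A x \<bullet> x - 2 * ?t * (norm (A x))\<^sup>2 + ?t\<^sup>2 * (A (A x) \<bullet> A x)"
    unfolding power2_norm_eq_inner
    by (simp add: linear_diff[OF A(1)] linear_cmul[OF A(1)] inner_diff_left inner_diff_right
        AAx power2_eq_square algebra_simps)
  also have "\<dots> \<le> A x \<bullet> x - 2 * ?t * (norm (A x))\<^sup>2 + ?t\<^sup>2 * (N * (norm (A x))\<^sup>2)"
    by (intro add_left_mono mult_left_mono le) auto
  also have "\<dots> = A x \<bullet> x - (norm (A x))\<^sup>2 / N"
    using N(1) by (simp add: power2_eq_square field_simps)
  finally show ?thesis using N(1) by (simp add: field_simps)
qed

locale operator_homomorphism = H: hilbert_space F H + H': hilbert_space F H'
  for F and H :: "'a::{real_inner, complete_space} hilbert_structure"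
    and H' :: "'b::{real_inner, complete_space} hilbert_structure" +
  fixes \<pi> :: "('a \<Rightarrow> 'a) \<Rightarrow> ('b \<Rightarrow> 'b)"
  assumes hom: "operator_hom F H H' \<pi>"
begin

section \<open>Transport of algebraic structure and positivity\<close>

lemma hom_bounded: "A \<in> bounded_ops F H \<Longrightarrow> \<pi> A \<in> bounded_ops F H'"
  using hom by (auto simp: operator_hom_def)

lemma hom_add:
  "A \<in> bounded_ops F H \<Longrightarrow> B \<in> bounded_ops F H \<Longrightarrow> \<pi> (\<lambda>x. A x + B x) = (\<lambda>y. \<pi> A y + \<pi> B y)"
  using hom by (simp add: operator_hom_def)

lemma hom_scaleR: "A \<in> bounded_ops F H \<Longrightarrow> \<pi> (\<lambda>x. r *\<^sub>R A x) = (\<lambda>y. r *\<^sub>R \<pi> A y)"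
proof -
  assume A: "A \<in> bounded_ops F H"
  have "\<pi> (\<lambda>x. scale H (of_real r) (A x)) = (\<lambda>y. scale H' (of_real r) (\<pi> A y))"
    using hom A H.of_real_in_F[of r] unfolding operator_hom_def by blast
  then show ?thesis by (simp add: H.scale_of_real H'.scale_of_real)
qed

lemma hom_diff:
  assumes "A \<in> bounded_ops F H" "B \<in> bounded_ops F H"
  shows "\<pi> (\<lambda>x. A x - B x) = (\<lambda>y. \<pi> A y - \<pi> B y)"
  using hom_add[OF assms(1) H.bounded_ops_intros(4)[OF assms(2), of "- 1"]] hom_scaleR[OF assms(2), of "- 1"]
  by simp

lemma hom_compose:
  "A \<in> bounded_ops F H \<Longrightarrow> B \<in> bounded_ops F H \<Longrightarrow> \<pi> (\<lambda>x. A (B x)) = (\<lambda>y. \<pi> A (\<pi> B y))"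
  using hom by (simp add: operator_hom_def comp_def)

lemma hom_id: "\<pi> (\<lambda>x. x) = (\<lambda>y. y)"
  using hom by (simp add: operator_hom_def id_def)

lemma hom_zero: "\<pi> (\<lambda>x. 0) = (\<lambda>y. 0)"
  using hom_scaleR[of "\<lambda>x. 0" 0] by simp

lemma hom_sum:
  assumes "\<And>i. i \<in> I \<Longrightarrow> A i \<in> bounded_ops F H"
  shows "\<pi> (\<lambda>x. \<Sum>i\<in>I. A i x) = (\<lambda>y. \<Sum>i\<in>I. \<pi> (A i) y)"
  using assms
proof (induction I rule: infinite_finite_induct)
  case (insert i I)
  then have "\<pi> (\<lambda>x. A i x + (\<Sum>i\<in>I. A i x)) = (\<lambda>y. \<pi> (A i) y + (\<Sum>i\<in>I. \<pi> (A i) y))"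
    by (subst hom_add) auto
  then show ?case using insert.hyps by simp
qed (simp_all add: hom_zero)

lemma hom_symmetric:
  assumes "A \<in> bounded_ops F H" "\<And>x y. A x \<bullet> y = x \<bullet> A y"
  shows "\<pi> A x \<bullet> y = x \<bullet> \<pi> A y"
proof -
  have "is_adjoint H A A" using assms by (simp add: H.is_adjoint_iff)
  then have "is_adjoint H' (\<pi> A) (\<pi> A)"
    using hom assms(1) unfolding operator_hom_def by blast
  then show ?thesis using H'.is_adjoint_iff[OF hom_bounded[OF assms(1)]] by blast
qed

lemma hom_projection:
  assumes "P \<in> projections F H"
  shows "\<pi> P \<in> projections F H'"
proof -
  note P = H.projectionsD[OF assms]
  have "(\<lambda>x. P (P x)) = P" by (simp add: P(2))
  then have "\<pi> P (\<pi> P y) = \<pi> P y" for y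
    using fun_cong[OF hom_compose[OF P(1) P(1)], of y] by (simp only:)
  then show ?thesis
    using hom_bounded[OF P(1)] hom_symmetric[OF P(1) P(3)] by (simp add: H'.projections_iff)
qed

text \<open>
  Were the infimum \<open>-m\<close> of the numerical range of \<open>\<pi> A\<close> negative, \<open>A + m\<close> would be coercive, hence
  invertible, and applying \<open>\<pi>\<close> to the inverse bounds \<open>\<pi> A + m\<close> away from \<open>0\<close>.
\<close>

lemma hom_positive:
  assumes A: "A \<in> bounded_ops F H" "\<And>x y. A x \<bullet> y = x \<bullet> A y" "\<And>x. 0 \<le> A x \<bullet> x"
  shows "0 \<le> \<pi> A y \<bullet> y"
proof (rule ccontr)
  assume neg: "\<not> 0 \<le> \<pi> A y \<bullet> y"
  note pA = hom_bounded[OF A(1)]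
  define X where "X = {\<pi> A y \<bullet> y | y. norm y = 1}"
  define m where "m = - Inf X"
  have scaled: "\<pi> A ((1 / norm y) *\<^sub>R y) \<bullet> ((1 / norm y) *\<^sub>R y) = (\<pi> A y \<bullet> y) / (norm y)\<^sup>2" for y
    by (simp add: H'.bounded_ops_linear[OF pA] power2_eq_square)
  have inX: "(\<pi> A y \<bullet> y) / (norm y)\<^sup>2 \<in> X" if "y \<noteq> 0" for y
    unfolding X_def
    by (intro CollectI exI[of _ "(1 / norm y) *\<^sub>R y"] conjI scaled[symmetric]) (use that in simp)
  have y0: "y \<noteq> 0" using neg by auto
  obtain K where K: "K > 0" "\<And>y. norm (\<pi> A y) \<le> K * norm y"
    using H'.bounded_ops_bound[OF pA] by blast
  have bdd: "bdd_below X"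
  proof (rule bdd_belowI)
    fix t assume "t \<in> X"
    then obtain z where z: "norm z = 1" "t = \<pi> A z \<bullet> z" by (auto simp: X_def)
    have "\<bar>\<pi> A z \<bullet> z\<bar> \<le> norm (\<pi> A z) * norm z" by (rule Cauchy_Schwarz_ineq2)
    then show "- K \<le> t" using K(2)[of z] z by auto
  qed
  have "Inf X \<le> (\<pi> A y \<bullet> y) / (norm y)\<^sup>2" by (rule cInf_lower[OF inX[OF y0] bdd])
  also have "\<dots> < 0" using neg y0 by (simp add: divide_neg_pos)
  finally have m: "m > 0" by (simp add: m_def)
  have lower: "- m * (norm z)\<^sup>2 \<le> \<pi> A z \<bullet> z" for z
  proof (cases "z = 0")
    case False
    have "- m \<le> (\<pi> A z \<bullet> z) / (norm z)\<^sup>2"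
      using cInf_lower[OF inX[OF False] bdd] by (simp add: m_def)
    then show ?thesis using False by (simp add: field_simps)
  qed simp
  define B where "B = (\<lambda>x. A x + m *\<^sub>R x)"
  have BB: "B \<in> bounded_ops F H" unfolding B_def using A(1) by simp
  have pB: "\<pi> B = (\<lambda>z. \<pi> A z + m *\<^sub>R z)"
    unfolding B_def using hom_add[OF A(1) H.bounded_ops_intros(4)[OF H.bounded_ops_intros(5), of m]]
    by (simp add: hom_scaleR[OF H.bounded_ops_intros(5)] hom_id)
  have "m * (x \<bullet> x) \<le> B x \<bullet> x" for x
    using A(3)[of x] by (simp add: B_def inner_add_left)
  then obtain G where G: "G \<in> bounded_ops F H" "\<And>x. G (B x) = x"
    by (rule H.coercive_inverse[OF BB m]) blast
  have GB: "\<pi> G (\<pi> B z) = z" for z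
    using fun_cong[OF hom_compose[OF G(1) BB], of z] by (simp add: G(2) hom_id)
  obtain L where L: "L > 0" "\<And>z. norm (\<pi> G z) \<le> L * norm z"
    using H'.bounded_ops_bound[OF hom_bounded[OF G(1)]] by blast
  note pBB = hom_bounded[OF BB]
  obtain N where N: "N > 0" "\<And>z. norm (\<pi> B z) \<le> N * norm z"
    using H'.bounded_ops_bound[OF pBB] by blast
  have CS: "(norm (\<pi> B z))\<^sup>2 \<le> N * (\<pi> B z \<bullet> z)" for z
  proof (rule positive_Cauchy_Schwarz[OF _ _ _ N])
    show "linear (\<pi> B)" using H'.bounded_opsD(1)[OF pBB] by (rule bounded_linear.linear)
    show "\<pi> B u \<bullet> v = u \<bullet> \<pi> B v" for u v
      using hom_symmetric[OF A(1,2)] by (simp add: pB inner_add_left inner_add_right)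
    show "0 \<le> \<pi> B u \<bullet> u" for u
      using lower[of u] by (simp add: pB inner_add_left power2_norm_eq_inner)
  qed
  \<comment> \<open>For a unit vector \<open>z\<close>, combining
    \<open>1 \<le> L * norm (\<pi> B z)\<close> with \<open>CS\<close> gives
    \<open>\<delta> \<le> \<pi> B z \<bullet> z\<close>, which would raise the infimum
    \<open>-m\<close> of the form of \<open>\<pi> A\<close> by \<open>\<delta>\<close>.\<close>
  define \<delta> where "\<delta> = 1 / (L\<^sup>2 * N)"
  have \<delta>: "\<delta> > 0" using L N by (simp add: \<delta>_def)
  have "Inf X \<ge> - m + \<delta>"
  proof (rule cInf_greatest)
    show "X \<noteq> {}" using inX[OF y0] by blast
    fix t assume "t \<in> X"
    then obtain z where z: "norm z = 1" "t = \<pi> A z \<bullet> z" by (auto simp: X_def)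
    have "1 \<le> L * norm (\<pi> B z)" using L(2)[of "\<pi> B z"] GB[of z] z(1) by simp
    then have "1\<^sup>2 \<le> (L * norm (\<pi> B z))\<^sup>2" by (intro power_mono) auto
    also have "\<dots> \<le> L\<^sup>2 * (N * (\<pi> B z \<bullet> z))"
      unfolding power_mult_distrib by (intro mult_left_mono CS) auto
    finally have "\<delta> \<le> \<pi> B z \<bullet> z"
      using L(1) N(1) by (simp add: \<delta>_def divide_le_eq mult.commute mult.left_commute)
    also have "\<dots> = t + m"
      using z by (simp add: pB inner_add_left dot_square_norm)
    finally show "- m + \<delta> \<le> t" by simp
  qed
  then show False using \<delta> by (simp add: m_def)
qed

text \<open>All \<open>\<pi> (p i)\<close> vanish on the kernel of \<open>R\<close>. At a vector
  \<open>w\<close> of that kernel the image of \<open>A = C (p 0 + ... + p (k-1)) - P\<close> has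
  the form \<open>- (norm (\<pi> P w))\<^sup>2\<close>, so positivity forces \<open>\<pi> P\<close>
  to vanish there too.\<close>

lemma hom_range_subset_upper_bound:
  assumes p: "\<And>n. p n \<in> projections F H" and P: "P \<in> projections F H"
    and sub: "range P \<subseteq> algebraic_sum (\<lambda>n. range (p n))"
    and R: "R \<in> projections F H'" "\<And>n. range (\<pi> (p n)) \<subseteq> range R"
  shows "range (\<pi> P) \<subseteq> range R"
proof -
  obtain C k where C: "\<And>x. (norm (P x))\<^sup>2 \<le> C * (\<Sum>i<k. (norm (p i x))\<^sup>2)"
    by (rule H.range_subset_dominated[OF p P sub]) blast
  note pB = H.projectionsD(1)[OF p] and PB = H.projectionsD(1)[OF P]
  define A where "A = (\<lambda>x. C *\<^sub>R (\<Sum>i<k. p i x) - P x)"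
  have SB: "(\<lambda>x. \<Sum>i<k. p i x) \<in> bounded_ops F H" using pB by (rule H.bounded_ops_sum)
  have AB: "A \<in> bounded_ops F H"
    unfolding A_def by (rule H.bounded_ops_intros(2)[OF H.bounded_ops_intros(4)[OF SB] PB])
  have pA: "\<pi> A = (\<lambda>y. C *\<^sub>R (\<Sum>i<k. \<pi> (p i) y) - \<pi> P y)"
    unfolding A_def using hom_diff[OF H.bounded_ops_intros(4)[OF SB] PB] hom_scaleR[OF SB]
      hom_sum[of "{..<k}" p] pB by simp
  have sym: "A x \<bullet> y = x \<bullet> A y" for x y
    by (simp add: A_def inner_diff_left inner_diff_right inner_sum_left inner_sum_right
        H.projectionsD(3)[OF p] H.projectionsD(3)[OF P])
  have pos: "0 \<le> A x \<bullet> x" for x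
    using C[of x] by (simp add: A_def inner_diff_left inner_sum_left H.projection_norm_sq[OF p]
        H.projection_norm_sq[OF P])
  have PR: "\<pi> P (R y) = \<pi> P y" for y
  proof -
    define w where "w = y - R y"
    have "\<pi> (p i) w = 0" for i
      unfolding w_def
      using H'.projection_diff(3)[OF hom_projection[OF p] R, of i y]
      by (simp add: H'.bounded_ops_linear[OF hom_bounded[OF pB]])
    then have "\<pi> A w \<bullet> w = - (\<pi> P w \<bullet> w)" by (simp add: pA)
    then have "\<pi> P w = 0"
      using hom_positive[OF AB sym pos, of w] H'.projection_norm_sq[OF hom_projection[OF P], of w]
      by simp
    then show ?thesis
      by (simp add: w_def H'.bounded_ops_linear[OF hom_bounded[OF PB]])
  qed
  \<comment> \<open>The adjoint of \<open>\<pi> P \<circ> R = \<pi> P\<close>; it places the range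
    of \<open>\<pi> P\<close> in that of \<open>R\<close>.\<close>
  have RP: "R (\<pi> P y) \<bullet> z = \<pi> P y \<bullet> z" for y z
    by (simp add: H'.projectionsD(3)[OF R(1)] H'.projectionsD(3)[OF hom_projection[OF P]] PR)
  have "R (\<pi> P y) = \<pi> P y" for y
    using vector_eq_rdot[of "R (\<pi> P y)" "\<pi> P y"] RP[of y] by simp
  then show ?thesis using H'.projectionsD(5)[OF R(1)] by blast
qed

text \<open>Existence and uniqueness of the least upper bound turn an equation with a definite
  description into the defining property.\<close>

lemma hom_eq_proj_Sup_iff:
  fixes p :: "nat \<Rightarrow> 'a \<Rightarrow> 'a"
  assumes "\<And>n. p n \<in> projections F H"
  shows "\<pi> P = proj_Sup F H' (range (\<lambda>n. \<pi> (p n))) \<longleftrightarrow>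
    is_proj_lub F H' (range (\<lambda>n. \<pi> (p n))) (\<pi> P)"
proof -
  obtain Q where Q: "is_proj_lub F H' (range (\<lambda>n. \<pi> (p n))) Q"
    by (rule H'.proj_lub_exists[of "\<lambda>n. \<pi> (p n)", OF hom_projection[OF assms]]) blast
  then show ?thesis using H'.proj_Sup_eqI by metis
qed

lemma hom_eq_proj_Sup_iff_no_extension:
  assumes ker: "\<And>A. A \<in> bounded_ops F H \<Longrightarrow> \<pi> A = (\<lambda>y. 0) \<longleftrightarrow> A \<in> compact_ops F H"
    and p: "\<And>n. p n \<in> projections F H" and P: "P \<in> projections F H"
    and sub: "range P \<subseteq> algebraic_sum (\<lambda>n. range (p n))"
  shows "\<pi> P = proj_Sup F H' (range (\<lambda>n. \<pi> (p n))) \<longleftrightarrow>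
    \<not> (\<exists>V. is_subspace F H V \<and> closed V \<and> range P \<subseteq> V \<and>
        V \<subseteq> algebraic_sum (\<lambda>n. range (p n)) \<and> infinite_dim_quotient F H V (range P))"
    (is "_ \<longleftrightarrow> \<not> ?ext")
  unfolding hom_eq_proj_Sup_iff[OF p]
proof
  assume lub: "is_proj_lub F H' (range (\<lambda>n. \<pi> (p n))) (\<pi> P)"
  note PB = H.projectionsD(1)[OF P] and pP = hom_projection[OF P]
  show "\<not> ?ext"
  proof
    assume ?ext
    then obtain V where V: "is_subspace F H V" "closed V" "range P \<subseteq> V"
      "V \<subseteq> algebraic_sum (\<lambda>n. range (p n))" "infinite_dim_quotient F H V (range P)"
      by blast
    obtain Q where Q: "Q \<in> projections F H" "range Q = V"
      by (rule H.closed_subspace_projection[OF V(1,2)])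
    note QB = H.projectionsD(1)[OF Q(1)]
    have PQ: "range P \<subseteq> range Q" using V(3) Q(2) by simp
    \<comment> \<open>The extension also lies in the algebraic sum, so domination applies to
      \<open>Q\<close> as well, with \<open>\<pi> P\<close> as the upper bound.\<close>
    have "range (\<pi> Q) \<subseteq> range (\<pi> P)"
    proof (rule hom_range_subset_upper_bound[OF p Q(1) _ pP])
      show "range Q \<subseteq> algebraic_sum (\<lambda>n. range (p n))" using V(4) Q(2) by simp
      show "range (\<pi> (p n)) \<subseteq> range (\<pi> P)" for n using lub by (auto simp: is_proj_lub_def)
    qed
    moreover have "range (\<pi> P) \<subseteq> range (\<pi> Q)"
    proof
      fix y assume "y \<in> range (\<pi> P)"
      then obtain x where x: "y = \<pi> P x" by blast
      have "(\<lambda>x. Q (P x)) = P" by (simp add: H.projection_diff(2)[OF P Q(1) PQ])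
      then have "\<pi> Q (\<pi> P x) = \<pi> P x"
        using fun_cong[OF hom_compose[OF QB PB], of x] by (simp only:)
      then show "y \<in> range (\<pi> Q)" unfolding x by (metis rangeI)
    qed
    ultimately have "\<pi> Q = \<pi> P"
      by (intro H'.projection_eqI hom_projection Q(1) P subset_antisym)
    then have "\<pi> (\<lambda>x. Q x - P x) = (\<lambda>y. 0)" by (simp add: hom_diff[OF QB PB])
    then have "(\<lambda>x. Q x - P x) \<in> compact_ops F H" using ker QB PB by blast
    then show False
      using H.infinite_dim_quotient_iff[OF P Q(1) PQ] V(5) Q(2) by simp
  qed
next
  assume no: "\<not> ?ext"
  note PB = H.projectionsD(1)[OF P] and pP = hom_projection[OF P]
  have up: "range (\<pi> (p n)) \<subseteq> range (\<pi> P)" for n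
  proof -
    note pB = H.projectionsD(1)[OF p, of n]
    \<comment> \<open>A single \<open>p n\<close> violating this would already yield a forbidden
      extension inside \<open>range P + range (p n)\<close>.\<close>
    have comp: "(\<lambda>x. p n x - P (p n x)) \<in> compact_ops F H"
    proof (rule ccontr)
      assume "(\<lambda>x. p n x - P (p n x)) \<notin> compact_ops F H"
      then obtain V where V: "is_subspace F H V" "closed V" "range P \<subseteq> V"
        "\<And>v. v \<in> V \<Longrightarrow> \<exists>a\<in>range P. \<exists>b\<in>range (p n). v = a + b"
        "infinite_dim_quotient F H V (range P)"
        by (rule H.noncompact_extension[OF P p]) blast
      have "V \<subseteq> algebraic_sum (\<lambda>n. range (p n))"
      proof
        fix v assume "v \<in> V"
        then obtain a b where ab: "a \<in> range P" "b \<in> range (p n)" "v = a + b"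
          using V(4) by meson
        have "a \<in> algebraic_sum (\<lambda>n. range (p n))" using ab(1) sub by blast
        moreover have "b \<in> algebraic_sum (\<lambda>n. range (p n))"
          using ab(2) algebraic_sum_upper[of "\<lambda>n. range (p n)" n] by blast
        ultimately show "v \<in> algebraic_sum (\<lambda>n. range (p n))"
          unfolding ab(3) by (rule algebraic_sum_add)
      qed
      with no V show False by blast
    qed
    have "\<pi> (\<lambda>x. p n x - P (p n x)) = (\<lambda>y. 0)"
      using ker[OF H.compact_ops_bounded[OF comp]] comp by simp
    then have "\<pi> (p n) y = \<pi> P (\<pi> (p n) y)" for y
      using fun_cong[OF hom_diff[OF pB H.bounded_ops_intros(3)[OF PB pB]], of y]
        fun_cong[OF hom_compose[OF PB pB], of y] by simp
    then show ?thesis using H'.projectionsD(5)[OF pP] by auto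
  qed
  show "is_proj_lub F H' (range (\<lambda>n. \<pi> (p n))) (\<pi> P)"
    unfolding is_proj_lub_def
  proof (intro conjI pP ballI impI)
    show "range S \<subseteq> range (\<pi> P)" if "S \<in> range (\<lambda>n. \<pi> (p n))" for S
      using that up by blast
    show "range (\<pi> P) \<subseteq> range R"
      if "R \<in> projections F H'" "\<forall>S\<in>range (\<lambda>n. \<pi> (p n)). range S \<subseteq> range R" for R
      by (rule hom_range_subset_upper_bound[OF p P sub that(1)]) (use that(2) in blast)
  qed
qed

text \<open>If the sum is closed, the join \<open>Q\<close> meets the hypothesis of the first
  equivalence and \<open>range Q\<close> is its own largest extension. For the converse that
  equivalence is out of reach, since \<open>range Q\<close> leaves a sum that is not closed.\<close>

lemma closed_sum_iff_hom_proj_Sup: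
  assumes ker: "\<And>A. A \<in> bounded_ops F H \<Longrightarrow> \<pi> A = (\<lambda>y. 0) \<longleftrightarrow> A \<in> compact_ops F H"
    and p: "\<And>n. p n \<in> projections F H"
  shows "closed (algebraic_sum (\<lambda>n. range (p n))) \<longleftrightarrow>
    \<pi> (proj_Sup F H (range p)) = proj_Sup F H' (range (\<lambda>n. \<pi> (p n)))"
proof -
  let ?M = "algebraic_sum (\<lambda>n. range (p n))"
  obtain Q where lub: "is_proj_lub F H (range p) Q" and Qr: "range Q = closure ?M"
    by (rule H.proj_lub_exists[OF p])
  have Q: "Q \<in> projections F H" using lub by (simp add: is_proj_lub_def)
  note QB = H.projectionsD(1)[OF Q]
  have "closed ?M \<longleftrightarrow> \<pi> Q = proj_Sup F H' (range (\<lambda>n. \<pi> (p n)))"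
  proof
    assume cl: "closed ?M"
    then have QM: "range Q = ?M" using Qr by (simp add: closure_closed)
    \<comment> \<open>Compactness of the zero operator, read through
      \<open>infinite_dim_quotient_iff\<close>, makes the trivial quotient finite
      dimensional.\<close>
    have "(\<lambda>x. Q x - Q x) \<in> compact_ops F H"
      by (auto simp: H.compact_ops_iff intro: exI[of _ "{0}"])
    then have fin: "\<not> infinite_dim_quotient F H (range Q) (range Q)"
      using H.infinite_dim_quotient_iff[OF Q Q order_refl] by blast
    have sub: "range Q \<subseteq> ?M" using QM by simp
    show "\<pi> Q = proj_Sup F H' (range (\<lambda>n. \<pi> (p n)))"
    proof (rule hom_eq_proj_Sup_iff_no_extension[OF ker p Q sub, THEN iffD2], assumption,
        rule notI, elim exE conjE)
      fix V assume "range Q \<subseteq> V" "V \<subseteq> ?M" and inf: "infinite_dim_quotient F H V (range Q)"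
      then have "V = range Q" unfolding QM by (intro subset_antisym)
      with inf fin show False by simp
    qed
  next
    assume "\<pi> Q = proj_Sup F H' (range (\<lambda>n. \<pi> (p n)))"
    then have lub': "is_proj_lub F H' (range (\<lambda>n. \<pi> (p n))) (\<pi> Q)"
      by (simp only: hom_eq_proj_Sup_iff[OF p])
    show "closed ?M"
    proof (rule ccontr)
      assume "\<not> closed ?M"
      then obtain K where K: "K \<in> projections F H" "K \<notin> compact_ops F H" "range K \<subseteq> closure ?M"
        "\<And>i. (\<lambda>x. p i (K x)) \<in> compact_ops F H"
        by (rule H.nonclosed_sum_noncompact_projection[OF p]) blast
      note KB = H.projectionsD(1)[OF K(1)] and pK = hom_projection[OF K(1)]
      define R where "R = (\<lambda>y. y - \<pi> K y)"
      have R: "R \<in> projections F H'"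
        unfolding R_def by (rule H'.projection_diff(1)[OF pK H'.projection_id]) auto
      have pk0: "\<pi> (p i) (\<pi> K y) = 0" for i y
      proof -
        have "\<pi> (\<lambda>x. p i (K x)) = (\<lambda>y. 0)"
          using ker[OF H.compact_ops_bounded[OF K(4)]] K(4) by simp
        then show ?thesis
          using fun_cong[OF hom_compose[OF H.projectionsD(1)[OF p] KB], of i y] by simp
      qed
      have "range (\<pi> (p i)) \<subseteq> range R" for i
      proof -
        \<comment> \<open>Both factors are symmetric, so the product vanishes in this order as
          well.\<close>
        have "\<pi> K (\<pi> (p i) y) \<bullet> z = 0" for y z
          by (simp add: H'.projectionsD(3)[OF pK] H'.projectionsD(3)[OF hom_projection[OF p]] pk0)
        then have "\<pi> K (\<pi> (p i) y) = 0" for y by (metis inner_eq_zero_iff)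
        then have "R (\<pi> (p i) y) = \<pi> (p i) y" for y by (simp add: R_def)
        then show ?thesis using H'.projectionsD(5)[OF R] by blast
      qed
      then have QR: "range (\<pi> Q) \<subseteq> range R"
        using lub' R by (auto simp: is_proj_lub_def)
      have KQ: "range K \<subseteq> range Q" using K(3) Qr by simp
      \<comment> \<open>\<open>\<pi> K\<close> lies below \<open>\<pi> Q\<close>, which lies below
        \<open>R = 1 - \<pi> K\<close>; thus the range of \<open>\<pi> K\<close> is orthogonal to
        itself.\<close>
      have "\<pi> K y = 0" for y
      proof -
        have "(\<lambda>x. Q (K x)) = K" by (simp add: H.projection_diff(2)[OF K(1) Q KQ])
        then have "\<pi> Q (\<pi> K y) = \<pi> K y"
          using fun_cong[OF hom_compose[OF QB KB], of y] by (simp only:)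
        then have "\<pi> K y \<in> range R" using QR by (metis rangeI subsetD)
        then have "R (\<pi> K y) = \<pi> K y" using H'.projectionsD(5)[OF R] by blast
        then show ?thesis by (simp add: R_def H'.projectionsD(2)[OF pK])
      qed
      then have "\<pi> K = (\<lambda>y. 0)" by blast
      then show False using ker[OF KB] K(2) by blast
    qed
  qed
  then show ?thesis by (simp add: H.proj_Sup_eqI[OF lub])
qed

end

theorem corollary6p3:
  fixes F :: "complex set"
    and H :: "'a::{real_inner, complete_space} hilbert_structure"
    and H' :: "'b::{real_inner, complete_space} hilbert_structure"
    and \<pi> :: "('a \<Rightarrow> 'a) \<Rightarrow> ('b \<Rightarrow> 'b)"
    and Pn :: "nat \<Rightarrow> 'a \<Rightarrow> 'a"
    and P :: "'a \<Rightarrow> 'a"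
  assumes "hilbert_space F H"
    and "hilbert_space F H'"
    and "operator_hom F H H' \<pi>"
    and "{A \<in> bounded_ops F H. \<pi> A = (\<lambda>y. 0)} = compact_ops F H"
    and "\<And>n. Pn n \<in> projections F H"
    and "P \<in> projections F H"
    and "range P \<subseteq> algebraic_sum (\<lambda>n. range (Pn n))"
  shows "(\<pi> P = proj_Sup F H' (range (\<lambda>n. \<pi> (Pn n))) \<longleftrightarrow>
            \<not> (\<exists>V. is_subspace F H V \<and> closed V \<and> range P \<subseteq> V \<and>
                   V \<subseteq> algebraic_sum (\<lambda>n. range (Pn n)) \<and>
                   infinite_dim_quotient F H V (range P))) \<and>
         (closed (algebraic_sum (\<lambda>n. range (Pn n))) \<longleftrightarrow>
            \<pi> (proj_Sup F H (range Pn)) = proj_Sup F H' (range (\<lambda>n. \<pi> (Pn n))))"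
proof -
  interpret operator_homomorphism F H H' \<pi>
    using assms(1-3) by (simp add: operator_homomorphism_def operator_homomorphism_axioms_def)
  have ker: "\<pi> A = (\<lambda>y. 0) \<longleftrightarrow> A \<in> compact_ops F H" if "A \<in> bounded_ops F H" for A
    using assms(4) that by blast
  show ?thesis
    using hom_eq_proj_Sup_iff_no_extension[OF ker assms(5-7)]
      closed_sum_iff_hom_proj_Sup[OF ker assms(5)] by (rule conjI)
qed

end
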